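(* Let $X$ be a compact metric space and $T\colon X\to X$ a continuous mapping. For each $\mu\in M_T(X)$ the measure $\mu^*=V(\mu)$ is a Choquet distribution on $\mathrm{Erg}\,X$ with barycenter $\mu$, and for all bounded Borel functions $f$ on $X$ the following equalities hold: $$ f(\mu)=\int_{X_0} f(V(x))\,d\mu(x)=\int_{\mathrm{Erg}\,X} f(\nu)\,d\mu^*(\nu). $$
   Context: $M(X)$ is the set of all Borel probability measures on $X$ with the weak topology generated by continuous functions; $M_T(X)\subset M(X)$ is the subset of $T$-invariant measures; $\mathrm{Erg}\,X\subset M_T(X)$ is the set of ergodic measures of $(X,T)$, with the Borel structure of the induced weak topology. For a bounded Borel function $f$ on $X$ and $\nu\in M(X)$ write $f(\nu)=\int_X f\,d\nu$. For $x\in X$, $n\ge1$ let $\delta_{x,n}=\frac1n(\delta_x+\delta_{Tx}+\dots+\delta_{T^{n-1}x})$, where $\delta_x$ is the unit mass at $x$. The ergodic support $X_0$ is the set of all $x\in X$ such that $\delta_{x,n}$ converges weakly to some ergodic measure as $n\to\infty$. The mapping $V\colon X_0\to\mathrm{Erg}\,X$ is $V(x)=\lim_{n\to\infty}\delta_{x,n}$ (weak limit), so $f(V(x))=\int_X f\,dV(x)$. For $\mu\in M_T(X)$, the measure $\mu^*=V(\mu)$ on $\mathrm{Erg}\,X$ is defined by $\mu^*(A)=\mu(V^{-1}(A))=\mu(\{x\in X_0: V(x)\in A\})$ for Borel $A\subset\mathrm{Erg}\,X$. A Choquet distribution on $\mathrm{Erg}\,X$ with barycenter $\mu\in M_T(X)$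 is a Borel probability measure $\mu^*$ on $\mathrm{Erg}\,X$ such that $f(\mu)=\int_{\mathrm{Erg}\,X} f(\nu)\,d\mu^*(\nu)$ for all $f\in C(X)$. *)

theory Defs
  imports "HOL-Probability.Probability"
begin

text \<open>
  The phase space is the whole type \<open>'a\<close>; \<open>space (prob_algebra borel)\<close> is the set of all
  Borel probability measures on it, used here only as a set.  The sigma-algebra of
  \<open>prob_algebra\<close> (the one generated by evaluations) is not used: measures carry the weak topology.
\<close>

abbreviation borel_probs :: "'a::topological_space measure set" where
  "borel_probs \<equiv> space (prob_algebra borel)"

definition weak_topology :: "'a::topological_space measure topology" where
  "weak_topology = topology_generated_by
     {{\<mu> \<in> borel_probs. (\<integral>x. f x \<partial>\<mu>) \<in> U} | (f :: 'a \<Rightarrow> real) U. continuous_on UNIV f \<and> open U}"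

definition invariant_measures :: "('a::topological_space \<Rightarrow> 'a) \<Rightarrow> 'a measure set" where
  "invariant_measures T =
     {\<mu> \<in> borel_probs. \<forall>A\<in>sets borel. emeasure \<mu> (T -` A) = emeasure \<mu> A}"

definition ergodic_measures :: "('a::topological_space \<Rightarrow> 'a) \<Rightarrow> 'a measure set" where
  "ergodic_measures T =
     {\<mu> \<in> invariant_measures T.
        \<forall>A\<in>sets borel. T -` A = A \<longrightarrow> emeasure \<mu> A = 0 \<or> emeasure \<mu> A = 1}"

definition ergodic_borel :: "('a::topological_space \<Rightarrow> 'a) \<Rightarrow> 'a measure measure" where
  "ergodic_borel T = sigma (ergodic_measures T)
     {U. openin (subtopology weak_topology (ergodic_measures T)) U}"

definition empirical_measure ::
    "('a::topological_space \<Rightarrow> 'a) \<Rightarrow> 'a \<Rightarrow> nat \<Rightarrow> 'a measure" where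
  "empirical_measure T x n = measure_of UNIV (sets borel)
     (\<lambda>A. (\<Sum>i<n. emeasure (return borel ((T ^^ i) x)) A) / of_nat n)"

definition ergodic_support :: "('a::topological_space \<Rightarrow> 'a) \<Rightarrow> 'a set" where
  "ergodic_support T =
     {x. \<exists>\<nu>\<in>ergodic_measures T. limitin weak_topology (empirical_measure T x) \<nu> sequentially}"

text \<open>The limit is unique on a metric space, where \<open>weak_topology\<close> is Hausdorff.\<close>

definition limit_measure :: "('a::topological_space \<Rightarrow> 'a) \<Rightarrow> 'a \<Rightarrow> 'a measure" where
  "limit_measure T x = (THE \<nu>. limitin weak_topology (empirical_measure T x) \<nu> sequentially)"

text \<open>
  If the set function below is not countably additive, \<open>measure_of\<close> yields the null measure, and
  \<open>emeasure \<mu>\<close> is 0 on non-measurable sets.  Hence the result is a probability measure only if the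
  preimages of all Borel sets under \<open>limit_measure T\<close> are Borel and \<open>ergodic_support T\<close> has full
  measure, so nothing is hidden by these conventions.
\<close>

definition ergodic_pushforward ::
    "('a::topological_space \<Rightarrow> 'a) \<Rightarrow> 'a measure \<Rightarrow> 'a measure measure" where
  "ergodic_pushforward T \<mu> = measure_of (ergodic_measures T) (sets (ergodic_borel T))
     (\<lambda>A. emeasure \<mu> {x \<in> ergodic_support T. limit_measure T x \<in> A})"

definition choquet_distribution ::
    "('a::topological_space \<Rightarrow> 'a) \<Rightarrow> 'a measure measure \<Rightarrow> 'a measure \<Rightarrow> bool" where
  "choquet_distribution T m \<mu> \<longleftrightarrow>
     \<mu> \<in> invariant_measures T \<and>
     prob_space m \<and> space m = ergodic_measures T \<and> sets m = sets (ergodic_borel T) \<and>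
     (\<forall>f :: 'a \<Rightarrow> real. continuous_on UNIV f \<longrightarrow>
        (\<integral>x. f x \<partial>\<mu>) = (\<integral>\<nu>. (\<integral>x. f x \<partial>\<nu>) \<partial>m))"

lemma topspace_weak_topology: "topspace weak_topology = borel_probs"
proof -
  have "borel_probs \<in> {{\<mu> \<in> borel_probs. (\<integral>x. f x \<partial>\<mu>) \<in> U} | (f :: 'a \<Rightarrow> real) U.
      continuous_on UNIV f \<and> open U}"
    by (rule CollectI, rule exI[of _ "\<lambda>_. 0"], rule exI[of _ UNIV]) auto
  then show ?thesis
    unfolding weak_topology_def topology_generated_by_topspace by blast
qed

lemma emeasure_empirical_measure:
  assumes "A \<in> sets borel"
  shows "emeasure (empirical_measure T x n) A
    = (\<Sum>i<n. emeasure (return borel ((T ^^ i) x)) A) / of_nat n"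
proof -
  have "countably_additive (sets borel)
      (\<lambda>A. (\<Sum>i<n. emeasure (return borel ((T ^^ i) x)) A) / of_nat n)"
  proof (rule countably_additiveI)
    fix B :: "nat \<Rightarrow> 'a set"
    assume B: "range B \<subseteq> sets borel" "disjoint_family B"
    have "(\<Sum>k. (\<Sum>i<n. emeasure (return borel ((T ^^ i) x)) (B k)) / of_nat n)
        = (\<Sum>k. \<Sum>i<n. emeasure (return borel ((T ^^ i) x)) (B k)) / of_nat n"
      unfolding divide_ennreal_def by (rule ennreal_suminf_multc)
    also have "(\<Sum>k. \<Sum>i<n. emeasure (return borel ((T ^^ i) x)) (B k))
        = (\<Sum>i<n. \<Sum>k. emeasure (return borel ((T ^^ i) x)) (B k))"
      by (rule suminf_sum) auto
    also have "\<dots> = (\<Sum>i<n. emeasure (return borel ((T ^^ i) x)) (\<Union>k. B k))"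
      using B by (intro sum.cong refl suminf_emeasure) auto
    finally show "(\<Sum>k. (\<Sum>i<n. emeasure (return borel ((T ^^ i) x)) (B k)) / of_nat n)
        = (\<Sum>i<n. emeasure (return borel ((T ^^ i) x)) (\<Union>k. B k)) / of_nat n" .
  qed
  then show ?thesis
    unfolding empirical_measure_def
    using assms sets.sigma_algebra_axioms[of "borel :: 'a measure"]
    by (intro emeasure_measure_of_sigma) (auto simp: positive_def)
qed

lemma empirical_measure_in_borel_probs:
  assumes "n > 0"
  shows "empirical_measure T x n \<in> borel_probs"
proof -
  have "sets (empirical_measure T x n) = sets borel"
    unfolding empirical_measure_def
    using sets.sigma_sets_eq[of "borel :: 'a measure"] by simp
  moreover from this have "space (empirical_measure T x n) = UNIV"
    using sets_eq_imp_space_eq by fastforce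
  moreover have "emeasure (empirical_measure T x n) UNIV = 1"
    using assms by (subst emeasure_empirical_measure) (auto intro!: ennreal_divide_self simp: ennreal_of_nat_eq_real_of_nat)
  ultimately show ?thesis
    by (auto simp: space_prob_algebra intro!: prob_spaceI)
qed

lemma space_ergodic_borel: "space (ergodic_borel T) = ergodic_measures T"
  unfolding ergodic_borel_def by (rule space_measure_of) (use openin_subset in fastforce)

end

theory Submission
  imports Defs
begin

text \<open>
  Let \<open>\<mu>\<close> be invariant.  By Birkhoff's theorem, applied to countably many continuous functions whose
  linear span is uniformly dense, almost every point \<open>x\<close> is regular: the time average of every
  continuous function at \<open>x\<close> converges.  The limit is a normalised positive functional, hence the
  integral against a measure \<open>V x\<close> (Riesz), which is invariant.  Integrating the averages gives
  \<open>\<integral>f d\<mu> = \<integral>f(V x) d\<mu>(x)\<close>, first for continuous and then for bounded Borel \<open>f\<close>, for every invariant \<open>\<mu>\<close>.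

  Ergodicity of almost every \<open>V x\<close> follows by applying this identity twice.  Put \<open>h y = f(V y)\<close> for a
  continuous \<open>f\<close>.  Applied to the invariant measure \<open>V x\<close> it shows that \<open>h\<close> has mean \<open>h x\<close> under \<open>V x\<close>, so
  its variance there is \<open>\<integral>h\<^sup>2 d(V x) - (h x)\<^sup>2\<close>; applied to \<open>\<mu>\<close> and \<open>h\<^sup>2\<close> it shows that these variances
  integrate to zero.  Hence \<open>V y = V x\<close> for \<open>V x\<close>-almost every \<open>y\<close>, and this characterises ergodicity:
  a set \<open>A\<close> with \<open>T -` A = A\<close> and positive measure would otherwise yield, by conditioning on \<open>A\<close>, a second
  invariant measure with the same time averages.  The same countable family of variance conditions
  shows that the ergodic support is a Borel set.
\<close>

subsection \<open>The Riesz representation theorem on a compact metric space\<close>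

text \<open>The distance to the complement serves as \<open>d\<close>. The full space is a separate
  case because \<open>infdist x {}\<close> is 0 by convention.\<close>

lemma open_positivity_function:
  fixes U :: "'a::metric_space set"
  assumes "open U"
  obtains d :: "'a \<Rightarrow> real" where "continuous_on UNIV d" "\<And>x. 0 \<le> d x" "\<And>x. 0 < d x \<longleftrightarrow> x \<in> U"
proof (cases "U = UNIV")
  case True
  then show ?thesis by (intro that[of "\<lambda>_. 1"]) auto
next
  case False
  show ?thesis
  proof (rule that[of "\<lambda>x. infdist x (- U)"])
    show "0 < infdist x (- U) \<longleftrightarrow> x \<in> U" for x
      using in_closed_iff_infdist_zero[of "- U" x] assms False infdist_nonneg[of x "- U"]
      by (auto simp: less_le)
  qed (auto intro!: continuous_intros infdist_nonneg)
qed

text \<open>\<open>L\<close> has a value on every function, but the axioms constrain it only on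
  continuous ones. The normalisation \<open>L_one\<close> makes the representing measure a
  probability measure.\<close>

locale positive_functional =
  fixes L :: "('a::metric_space \<Rightarrow> real) \<Rightarrow> real"
  assumes compact_space: "compact (UNIV :: 'a set)"
    and L_add: "\<And>f g. continuous_on UNIV f \<Longrightarrow> continuous_on UNIV g \<Longrightarrow>
      L (\<lambda>x. f x + g x) = L f + L g"
    and L_scale: "\<And>c f. continuous_on UNIV f \<Longrightarrow> L (\<lambda>x. c * f x) = c * L f"
    and L_nonneg: "\<And>f. continuous_on UNIV f \<Longrightarrow> (\<And>x. 0 \<le> f x) \<Longrightarrow> 0 \<le> L f"
    and L_one: "L (\<lambda>_. 1) = 1"
begin

lemma L_const: "L (\<lambda>_. c) = c"
  using L_scale[of "\<lambda>_. 1" c] L_one by simp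

lemma L_diff:
  assumes "continuous_on UNIV f" "continuous_on UNIV g"
  shows "L (\<lambda>x. f x - g x) = L f - L g"
  using L_add[OF assms(1), of "\<lambda>x. (-1) * g x"] L_scale[OF assms(2), of "-1"] assms
  by (simp add: continuous_intros)

lemma L_mono:
  assumes "continuous_on UNIV f" "continuous_on UNIV g" "\<And>x. f x \<le> g x"
  shows "L f \<le> L g"
  using L_nonneg[of "\<lambda>x. g x - f x"] L_diff[OF assms(2,1)] assms
  by (simp add: continuous_intros)

lemma L_sum:
  assumes "\<And>i. i \<in> I \<Longrightarrow> continuous_on UNIV (f i)"
  shows "L (\<lambda>x. \<Sum>i\<in>I. f i x) = (\<Sum>i\<in>I. L (f i))"
proof (cases "finite I")
  case True
  then show ?thesis using assms
  proof (induction I rule: finite_induct)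
    case (insert i I)
    then have "L (\<lambda>x. f i x + (\<Sum>i\<in>I. f i x)) = L (f i) + L (\<lambda>x. \<Sum>i\<in>I. f i x)"
      by (intro L_add continuous_intros) auto
    then show ?case using insert by simp
  qed (simp add: L_const)
qed (simp add: L_const)

section \<open>The content of open sets and its outer measure\<close>

text \<open>Domination by the indicator replaces the usual condition that the support be contained
  in \<open>U\<close>. The room which that condition would give comes later from truncating at a
  small height.\<close>

definition below :: "'a set \<Rightarrow> ('a \<Rightarrow> real) set" where
  "below U = {f. continuous_on UNIV f \<and> (\<forall>x. 0 \<le> f x \<and> f x \<le> indicator U x)}"

definition open_content :: "'a set \<Rightarrow> ennreal" where
  "open_content U = (SUP f\<in>below U. ennreal (L f))"

definition outer :: "'a set \<Rightarrow> ennreal" where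
  "outer A = (INF U\<in>{U. open U \<and> A \<subseteq> U}. open_content U)"

lemma zero_below [simp]: "(\<lambda>_. 0) \<in> below U"
  by (auto simp: below_def)

lemma belowD:
  assumes "f \<in> below U"
  shows "continuous_on UNIV f" "0 \<le> f x" "f x \<le> 1" "0 < f x \<Longrightarrow> x \<in> U"
proof -
  have f: "continuous_on UNIV f" "0 \<le> f x" "f x \<le> indicator U x" using assms by (auto simp: below_def)
  then show "continuous_on UNIV f" "0 \<le> f x" by auto
  have "indicator U x \<le> (1::real)" by (rule indicator_le_1)
  with f(3) show "f x \<le> 1" by linarith
  show "x \<in> U" if "0 < f x" using f(3) that by (cases "x \<in> U") auto
qed

lemma below_mono: "U \<subseteq> V \<Longrightarrow> below U \<subseteq> below V"
  unfolding below_def by (auto simp: indicator_def split: if_splits) (meson order.trans zero_le_one subsetD)+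

lemma open_content_mono: "U \<subseteq> V \<Longrightarrow> open_content U \<le> open_content V"
  unfolding open_content_def by (intro SUP_subset_mono below_mono) auto

lemma open_content_upper: "f \<in> below U \<Longrightarrow> ennreal (L f) \<le> open_content U"
  unfolding open_content_def by (rule SUP_upper)

lemma outer_open: "open U \<Longrightarrow> outer U = open_content U"
  unfolding outer_def by (intro antisym INF_greatest INF_lower2[of U]) (auto intro: open_content_mono)

lemma outer_mono: "A \<subseteq> B \<Longrightarrow> outer A \<le> outer B"
  unfolding outer_def by (intro INF_superset_mono) auto

lemma open_content_empty: "open_content {} = 0"
proof -
  have "f = (\<lambda>_. 0)" if "f \<in> below {}" for f
    using that by (auto simp: below_def intro: antisym)
  then have "below {} = {\<lambda>_. 0}" using zero_below by blast
  then show ?thesis by (simp add: open_content_def L_const)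
qed

lemma open_content_UNIV: "open_content UNIV = 1"
proof (rule antisym)
  show "open_content UNIV \<le> 1"
    unfolding open_content_def
  proof (rule SUP_least)
    fix f assume f: "f \<in> below UNIV"
    then have "L f \<le> L (\<lambda>_. 1)" by (intro L_mono) (auto simp: below_def)
    then show "ennreal (L f) \<le> 1" using L_one by simp
  qed
  have "(\<lambda>_. 1) \<in> below UNIV" by (auto simp: below_def)
  from open_content_upper[OF this] show "1 \<le> open_content UNIV" using L_one by simp
qed

text \<open>Monotonicity suffices, since \<open>f\<close> lies below its truncation plus
  \<open>e\<close>. The gain is that the truncation vanishes outside the closed set where
  \<open>e \<le> f x\<close>.\<close>

lemma L_truncate:
  assumes "continuous_on UNIV f" "0 \<le> e"
  shows "L f \<le> L (\<lambda>x. max 0 (f x - e)) + e"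
proof -
  have "L f \<le> L (\<lambda>x. max 0 (f x - e) + e)"
    using assms by (intro L_mono continuous_intros) auto
  also have "\<dots> = L (\<lambda>x. max 0 (f x - e)) + L (\<lambda>_. e)"
    using assms by (intro L_add continuous_intros)
  finally show ?thesis by (simp add: L_const)
qed

text \<open>After truncation at height \<open>e\<close>, \<open>f\<close> lives on a compact set,
  which finitely many \<open>U i\<close> cover. A partition of unity splits the truncation into
  pieces \<open>F i\<close> below the \<open>U i\<close>, and additivity of \<open>L\<close> bounds
  \<open>L f\<close> up to \<open>e\<close>.\<close>

lemma open_content_countably_subadditive:
  fixes U :: "nat \<Rightarrow> 'a set"
  assumes U: "\<And>i. open (U i)"
  shows "open_content (\<Union>i. U i) \<le> (\<Sum>i. open_content (U i))"
  unfolding open_content_def[of "\<Union>i. U i"]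
proof (rule SUP_least, rule ennreal_le_epsilon)
  fix f and e :: real
  assume f: "f \<in> below (\<Union>i. U i)" and e: "0 < e"
  have fc[continuous_intros]: "continuous_on UNIV f" and f0: "\<And>x. 0 \<le> f x"
    and f1: "\<And>x. f x \<le> 1" and fU: "\<And>x. 0 < f x \<Longrightarrow> x \<in> (\<Union>i. U i)"
    using belowD[OF f] by auto
  have "\<forall>i. \<exists>d. continuous_on UNIV d \<and> (\<forall>x. 0 \<le> d x) \<and> (\<forall>x. (0::real) < d x \<longleftrightarrow> x \<in> U i)"
    using open_positivity_function[OF U] by metis
  then obtain d :: "nat \<Rightarrow> 'a \<Rightarrow> real" where dc[continuous_intros]: "\<And>i. continuous_on UNIV (d i)"
    and d0: "\<And>i x. 0 \<le> d i x" and dU: "\<And>i x. 0 < d i x \<longleftrightarrow> x \<in> U i"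
    by metis
  have "closed {x. e \<le> f x}" by (intro closed_Collect_le continuous_intros)
  then have "compact {x. e \<le> f x}" using compact_space closed_Int_compact[of _ UNIV] by auto
  moreover have "x \<in> (\<Union>i. U i)" if "e \<le> f x" for x using fU[of x] e that by linarith
  then have "{x. e \<le> f x} \<subseteq> (\<Union>i. U i)" by blast
  ultimately obtain I where I: "finite I" "{x. e \<le> f x} \<subseteq> (\<Union>i\<in>I. U i)"
    using U by (rule_tac compactE_image[of "{x. e \<le> f x}" UNIV U]) assumption+
  \<comment> \<open>The second summand keeps the denominator positive where no \<open>d i\<close>
    does. It vanishes where \<open>e \<le> f x\<close>, so the pieces still add up exactly to the
    truncation.\<close>
  define s where "s x = (\<Sum>i\<in>I. d i x) + max 0 (e - f x)" for x
  have s_pos: "0 < s x" for x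
  proof (cases "e \<le> f x")
    case True
    then obtain i where "i \<in> I" "0 < d i x" using I dU by blast
    then have "0 < (\<Sum>i\<in>I. d i x)" using I d0 by (intro sum_pos2) auto
    then show ?thesis by (simp add: s_def)
  next
    case False
    moreover have "0 \<le> (\<Sum>i\<in>I. d i x)" using d0 by (intro sum_nonneg)
    ultimately show ?thesis by (simp add: s_def)
  qed
  have s_ne: "s x \<noteq> 0" for x using s_pos[of x] by simp
  have sc[continuous_intros]: "continuous_on UNIV s"
    unfolding s_def by (intro continuous_intros)
  define F where "F i x = max 0 (f x - e) * d i x / s x" for i x
  have Fc: "continuous_on UNIV (F i)" for i
    unfolding F_def by (intro continuous_intros) (use s_ne in simp)
  have F_sum: "(\<Sum>i\<in>I. F i x) = max 0 (f x - e)" for x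
  proof (cases "e \<le> f x")
    case True
    then have "s x = (\<Sum>i\<in>I. d i x)" by (simp add: s_def)
    then show ?thesis using s_pos[of x]
      by (simp add: F_def flip: sum_divide_distrib sum_distrib_left)
  qed (simp add: F_def)
  have F0: "0 \<le> F i x" for i x
    unfolding F_def using d0 s_pos[of x] by (intro divide_nonneg_nonneg mult_nonneg_nonneg) auto
  have Fb: "F i \<in> below (U i)" if "i \<in> I" for i
  proof -
    have "F i x \<le> indicator (U i) x" for x
    proof (cases "x \<in> U i")
      case True
      have "F i x \<le> (\<Sum>i\<in>I. F i x)" using I that F0 by (intro member_le_sum) auto
      also have "\<dots> \<le> 1" using F_sum f1[of x] e by simp
      finally show ?thesis using True by simp
    next
      case False
      then have "d i x = 0" using d0[of i x] dU[of i x] by linarith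
      then show ?thesis using False by (simp add: F_def)
    qed
    then show ?thesis using Fc F0 by (auto simp: below_def)
  qed
  have "L f \<le> L (\<lambda>x. \<Sum>i\<in>I. F i x) + e"
    using L_truncate[OF fc, of e] e by (simp add: F_sum)
  also have "L (\<lambda>x. \<Sum>i\<in>I. F i x) = (\<Sum>i\<in>I. L (F i))"
    by (intro L_sum Fc)
  finally have "ennreal (L f) \<le> ennreal ((\<Sum>i\<in>I. L (F i)) + e)" by (rule ennreal_leI)
  also have "\<dots> = (\<Sum>i\<in>I. ennreal (L (F i))) + ennreal e"
    using e Fc F0 by (subst ennreal_plus) (auto intro!: sum_nonneg L_nonneg sum_ennreal[symmetric])
  also have "(\<Sum>i\<in>I. ennreal (L (F i))) \<le> (\<Sum>i\<in>I. open_content (U i))"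
    by (intro sum_mono open_content_upper Fb)
  also have "(\<Sum>i\<in>I. open_content (U i)) \<le> (\<Sum>i. open_content (U i))"
    using I by (intro sum_le_suminf) auto
  finally show "ennreal (L f) \<le> (\<Sum>i. open_content (U i)) + ennreal e"
    by simp
qed

lemma outer_approx:
  assumes "0 < e"
  obtains U where "open U" "A \<subseteq> U" "open_content U \<le> outer A + ennreal e"
proof -
  have "outer A \<le> outer UNIV" by (rule outer_mono) simp
  then have fin: "outer A < top" using outer_open[of UNIV] open_content_UNIV
    by (simp add: le_less_trans ennreal_one_less_top)
  then have "outer A < outer A + ennreal e"
    using assms by (simp add: ennreal_add_left_cancel_less ennreal_less_zero_iff)
  then obtain U where "open U" "A \<subseteq> U" "open_content U < outer A + ennreal e"
    unfolding outer_def[of A] INF_less_iff by auto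
  then show ?thesis by (intro that[of U]) auto
qed

lemma outer_countably_subadditive: "countably_subadditive UNIV outer"
  unfolding countably_subadditive_def
proof (intro allI impI, rule ennreal_le_epsilon)
  fix A :: "nat \<Rightarrow> 'a set" and e :: real
  assume e: "0 < e"
  let ?e = "\<lambda>i. e * (1/2) ^ Suc i"
  have "\<exists>U. open U \<and> A i \<subseteq> U \<and> open_content U \<le> outer (A i) + ennreal (?e i)" for i
    by (rule outer_approx[of "?e i" "A i"]) (use e in simp, blast)
  then obtain U where U: "\<And>i. open (U i)" "\<And>i. A i \<subseteq> U i"
    "\<And>i. open_content (U i) \<le> outer (A i) + ennreal (?e i)"
    by metis
  have "outer (\<Union>i. A i) \<le> open_content (\<Union>i. U i)"
    unfolding outer_def using U by (intro INF_lower) auto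
  also have "\<dots> \<le> (\<Sum>i. open_content (U i))"
    by (intro open_content_countably_subadditive U)
  also have "\<dots> \<le> (\<Sum>i. outer (A i) + ennreal (?e i))"
    by (intro suminf_le U) auto
  also have "\<dots> = (\<Sum>i. outer (A i)) + (\<Sum>i. ennreal (?e i))"
    by (intro suminf_add[symmetric]) auto
  also have "(\<Sum>i. ennreal (?e i)) = ennreal (e * 1)"
  proof (rule suminf_ennreal_eq)
    show "?e sums (e * 1)" by (intro sums_mult power_half_series)
  qed (use e in auto)
  finally show "outer (\<Union>i. A i) \<le> (\<Sum>i. outer (A i)) + ennreal e" by simp
qed

lemma outer_measure_space: "outer_measure_space UNIV outer"
  unfolding outer_measure_space_def
  using outer_countably_subadditive outer_open[of "{}"] open_content_empty outer_mono
  by (auto simp: positive_def increasing_def)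

text \<open>A function nearly optimal for \<open>U \<inter> V\<close> and one nearly optimal for a
  neighbourhood of \<open>V - U\<close> can be added without leaving \<open>below V\<close>,
  provided that their positivity sets are disjoint. Truncation of the first one achieves
  this.\<close>

lemma outer_split:
  assumes U: "open U" and V: "open V"
  shows "outer (U \<inter> V) + outer (V - U) \<le> open_content V"
proof -
  have *: "ennreal (L f) + outer (V - U) \<le> open_content V" if f: "f \<in> below (U \<inter> V)" for f
  proof (rule ennreal_le_epsilon)
    fix e :: real assume e: "0 < e"
    have fc[continuous_intros]: "continuous_on UNIV f" and f0: "\<And>x. 0 \<le> f x"
      and f1: "\<And>x. f x \<le> 1" and fU: "\<And>x. 0 < f x \<Longrightarrow> x \<in> U \<inter> V"
      using belowD[OF f] by auto
    define h where "h x = max 0 (f x - e)" for x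
    have hc: "continuous_on UNIV h" unfolding h_def by (intro continuous_intros)
    have h0: "0 \<le> L h" using hc by (rule L_nonneg) (simp add: h_def)
    \<comment> \<open>On \<open>W\<close> the truncation \<open>h\<close> is 0, and any
      \<open>g\<close> in \<open>below W\<close> is 0 off \<open>W\<close>, so \<open>h + g\<close>
      never exceeds the indicator of \<open>V\<close>. As \<open>f\<close> vanishes off
      \<open>U\<close>, the open set \<open>W\<close> still contains \<open>V - U\<close>.\<close>
    define W where "W = V - {x. e \<le> f x}"
    have W: "open W" unfolding W_def
      by (intro open_Diff V closed_Collect_le continuous_intros)
    have "x \<notin> V - U" if "e \<le> f x" for x using fU[of x] e that by auto
    then have "V - U \<subseteq> W" by (auto simp: W_def)
    then have "outer (V - U) \<le> open_content W" using W by (auto simp: outer_def intro: INF_lower)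
    then have "ennreal (L h) + outer (V - U) \<le> ennreal (L h) + open_content W"
      by (rule add_left_mono)
    also have "\<dots> = (SUP g\<in>below W. ennreal (L h) + ennreal (L g))"
      unfolding open_content_def by (intro ennreal_SUP_add_right) (use zero_below in blast)
    also have "\<dots> \<le> open_content V"
    proof (rule SUP_least)
      fix g assume g: "g \<in> below W"
      then have gc: "continuous_on UNIV g" and g0: "\<And>x. 0 \<le> g x" and gW: "\<And>x. g x \<le> indicator W x"
        by (auto simp: below_def)
      have "h x + g x \<le> indicator V x" for x
        using f1[of x] fU[of x] gW[of x] g0[of x] e
        by (auto simp: h_def W_def indicator_def max_def split: if_splits)
      then have "(\<lambda>x. h x + g x) \<in> below V"
        using hc gc g0 by (auto simp: below_def h_def intro!: continuous_intros add_nonneg_nonneg)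
      from open_content_upper[OF this] show "ennreal (L h) + ennreal (L g) \<le> open_content V"
        using hc gc h0 g0 by (simp add: L_add L_nonneg flip: ennreal_plus)
    qed
    finally have split: "ennreal (L h) + outer (V - U) \<le> open_content V" .
    have "ennreal (L f) \<le> ennreal (L h) + ennreal e"
      using L_truncate[OF fc, of e] e h0 by (simp add: h_def[abs_def] flip: ennreal_plus)
    then have "ennreal (L f) + outer (V - U) \<le> ennreal (L h) + ennreal e + outer (V - U)"
      by (rule add_right_mono)
    also have "\<dots> = ennreal (L h) + outer (V - U) + ennreal e" by (simp only: ac_simps)
    also have "\<dots> \<le> open_content V + ennreal e" using split by (rule add_right_mono)
    finally show "ennreal (L f) + outer (V - U) \<le> open_content V + ennreal e" .
  qed
  have "outer (U \<inter> V) + outer (V - U) = (SUP f\<in>below (U \<inter> V). ennreal (L f) + outer (V - U))"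
    unfolding outer_open[OF open_Int[OF U V]] open_content_def
    by (intro ennreal_SUP_add_left[symmetric]) (use zero_below in blast)+
  also have "\<dots> \<le> open_content V" by (rule SUP_least) (rule *)
  finally show ?thesis .
qed

text \<open>Since \<open>outer A\<close> is an infimum over open supersets of \<open>A\<close>, the
  nontrivial half of Caratheodory's condition reduces to open test sets, which is
  \<open>outer_split\<close>. The other half is subadditivity.\<close>

lemma open_in_lambda_system:
  assumes U: "open U"
  shows "U \<in> lambda_system UNIV UNIV outer"
proof -
  have "outer (U \<inter> A) + outer (- U \<inter> A) = outer A" for A
  proof (rule antisym)
    show "outer (U \<inter> A) + outer (- U \<inter> A) \<le> outer A"
      unfolding outer_def[of A]
    proof (rule INF_greatest)
      fix V assume V: "V \<in> {V. open V \<and> A \<subseteq> V}"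
      then have "outer (U \<inter> A) + outer (- U \<inter> A) \<le> outer (U \<inter> V) + outer (V - U)"
        by (intro add_mono outer_mono) auto
      also have "\<dots> \<le> open_content V" using U V by (intro outer_split) auto
      finally show "outer (U \<inter> A) + outer (- U \<inter> A) \<le> open_content V" .
    qed
    interpret sigma_algebra UNIV "UNIV :: 'a set set" using sigma_algebra_Pow[of UNIV] by simp
    have "subadditive UNIV outer"
      using outer_measure_space countably_subadditive_subadditive
      by (auto simp: outer_measure_space_def)
    from subadditiveD[OF this, of "U \<inter> A" "- U \<inter> A"]
    have "outer ((U \<inter> A) \<union> (- U \<inter> A)) \<le> outer (U \<inter> A) + outer (- U \<inter> A)" by auto
    moreover have "(U \<inter> A) \<union> (- U \<inter> A) = A" by blast
    ultimately show "outer A \<le> outer (U \<inter> A) + outer (- U \<inter> A)" by simp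
  qed
  then show ?thesis by (simp add: lambda_system_def Compl_eq_Diff_UNIV)
qed

section \<open>The representing measure\<close>

definition rep :: "'a measure" where
  "rep = measure_of UNIV (sets borel) outer"

lemma sets_rep [simp, measurable_cong]: "sets rep = sets borel"
  unfolding rep_def using sets.sigma_sets_eq[of "borel :: 'a measure"] by simp

lemma space_rep [simp]: "space rep = UNIV"
  using sets_eq_imp_space_eq[OF sets_rep] by simp

text \<open>The Caratheodory measurable sets form a sigma-algebra containing the open sets, hence
  all Borel sets. So \<open>outer\<close> is countably additive there and \<open>measure_of\<close>
  does not fall back to the null measure.\<close>

lemma emeasure_rep:
  assumes "A \<in> sets borel"
  shows "emeasure rep A = outer A"
proof -
  interpret sigma_algebra UNIV "UNIV :: 'a set set" using sigma_algebra_Pow[of UNIV] by simp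
  have ms: "measure_space UNIV (lambda_system UNIV UNIV outer) outer"
    by (rule caratheodory_lemma[OF outer_measure_space])
  then interpret l: sigma_algebra UNIV "lambda_system UNIV UNIV outer"
    by (simp add: measure_space_def)
  have "sets (borel :: 'a measure) \<subseteq> lambda_system UNIV UNIV outer"
    unfolding borel_def using open_in_lambda_system
    by (simp add: sets_measure_of) (intro l.sigma_sets_subset, auto)
  from measure_down[OF ms _ this] have "measure_space UNIV (sets borel) outer"
    using sets.sigma_algebra_axioms[of "borel :: 'a measure"] by simp
  then show ?thesis
    unfolding rep_def using assms sets.sigma_algebra_axioms[of "borel :: 'a measure"]
    by (intro emeasure_measure_of_sigma) (auto simp: measure_space_def)
qed

sublocale rep: prob_space rep
  by (rule prob_spaceI) (simp add: emeasure_rep outer_open open_content_UNIV)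

lemma L_le_measure_rep:
  assumes "open U" "f \<in> below U"
  shows "L f \<le> measure rep U"
proof -
  have "ennreal (L f) \<le> emeasure rep U"
    using open_content_upper[OF assms(2)] assms(1) by (simp add: emeasure_rep outer_open)
  then show ?thesis by (simp add: rep.emeasure_eq_measure)
qed

lemma count_below_real:
  fixes y :: real
  assumes "0 \<le> y"
  shows "(\<Sum>i<n. indicator {t. real i < t} y) \<le> y + 1"
proof -
  \<comment> \<open>The bound by \<open>min\<close> carries the induction: if the next indicator is
    1, then \<open>real n < y\<close>, and the new bound \<open>real n + 1\<close> is still below
    \<open>y + 1\<close>.\<close>
  have "(\<Sum>i<n. indicator {t. real i < t} y) \<le> min (real n) (y + 1)"
    by (induction n) (use assms in \<open>auto simp: indicator_def min_def split: if_splits\<close>)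
  then show ?thesis by simp
qed

lemma integrable_rep:
  assumes "continuous_on UNIV f"
  shows "integrable rep (f :: 'a \<Rightarrow> real)"
proof -
  have "bounded (range f)"
    using assms compact_space by (intro compact_imp_bounded compact_continuous_image)
  then obtain B where "\<And>x. norm (f x) \<le> B" by (auto simp: bounded_iff)
  then show ?thesis using assms
    by (intro rep.integrable_const_bound[of _ B])
      (auto simp: borel_measurable_continuous_onI cong: measurable_cong_sets)
qed

text \<open>The layers \<open>min f ((i+1)/n) - min f (i/n)\<close> sum up to \<open>f\<close>, and \<open>n\<close> times the \<open>i\<close>-th layer
  is dominated by the indicator of \<open>{f > i/n}\<close>.\<close>

lemma L_le_integral_unit:
  assumes fc[continuous_intros]: "continuous_on UNIV f" and f: "\<And>x. 0 \<le> f x" "\<And>x. f x \<le> 1"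
  shows "L f \<le> (\<integral>x. f x \<partial>rep)"
proof (rule field_le_epsilon)
  fix e :: real assume "0 < e"
  then obtain n where n: "n > 0" "1 / real n < e" by (metis nat_approx_posE of_nat_0_less_iff zero_less_Suc)
  define F where "F i x = real n * (min (f x) (real (Suc i) / n) - min (f x) (real i / n))" for i x
  have Fc[continuous_intros]: "continuous_on UNIV (F i)" for i
    unfolding F_def by (intro continuous_intros)
  have Fb: "F i \<in> below {x. real i < n * f x}" for i
    using Fc[of i] n by (auto simp: below_def F_def indicator_def min_def field_simps)
  have op: "open {x. real i < n * f x}" for i
    by (intro open_Collect_less continuous_intros)
  have sumF: "(\<Sum>i<n. F i x) = n * f x" for x
  proof -
    have "(\<Sum>i<n. F i x) = real n * (\<Sum>i<n. min (f x) (real (Suc i) / n) - min (f x) (real i / n))"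
      by (simp add: F_def sum_distrib_left)
    also have "\<dots> = real n * (min (f x) (real n / n) - min (f x) (real 0 / n))"
      by (subst sum_lessThan_telescope) simp
    also have "\<dots> = n * f x" using f[of x] n by (simp add: min_def)
    finally show ?thesis .
  qed
  have "n * L f = L (\<lambda>x. \<Sum>i<n. F i x)" by (simp add: sumF L_scale fc)
  also have "\<dots> = (\<Sum>i<n. L (F i))" by (intro L_sum Fc)
  also have "\<dots> \<le> (\<Sum>i<n. measure rep {x. real i < n * f x})"
    by (intro sum_mono L_le_measure_rep op Fb)
  also have "\<dots> = (\<Sum>i<n. \<integral>x. indicator {x. real i < n * f x} x \<partial>rep)"
    by simp
  also have "\<dots> = (\<integral>x. (\<Sum>i<n. indicator {x. real i < n * f x} x) \<partial>rep)"
    using op by (subst Bochner_Integration.integral_sum) (auto simp: rep.emeasure_eq_measure)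
  \<comment> \<open>A point lies in at most \<open>n * f x + 1\<close> of the superlevel sets. After
    division by \<open>n\<close> the surplus 1 becomes the error \<open>1 / n\<close>.\<close>
  also have "\<dots> \<le> (\<integral>x. n * f x + 1 \<partial>rep)"
  proof (rule integral_mono)
    show "integrable rep (\<lambda>x. \<Sum>i<n. indicator {x. real i < n * f x} x :: real)"
      using op by (intro Bochner_Integration.integrable_sum) (auto simp: rep.emeasure_eq_measure)
    show "integrable rep (\<lambda>x. n * f x + 1)" by (intro integrable_rep continuous_intros)
    show "(\<Sum>i<n. indicator {x. real i < n * f x} x) \<le> n * f x + 1" for x
      using count_below_real[of "n * f x" n] f[of x] by (simp add: indicator_def)
  qed
  also have "\<dots> = n * (\<integral>x. f x \<partial>rep) + 1"
    using integrable_rep[OF fc] by (simp add: rep.prob_space[simplified])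
  finally have "L f \<le> (\<integral>x. f x \<partial>rep) + 1 / n" using n by (simp add: field_simps)
  then show "L f \<le> (\<integral>x. f x \<partial>rep) + e" using n by simp
qed

text \<open>For values in the unit interval, the one-sided estimate
  \<open>L_le_integral_unit\<close> applied to \<open>f\<close> and to \<open>1 - f\<close> gives
  equality. A general continuous function is bounded by compactness and reduces to this case by an
  affine rescaling.\<close>

lemma integral_rep:
  assumes fc[continuous_intros]: "continuous_on UNIV f"
  shows "(\<integral>x. f x \<partial>rep) = L f"
proof -
  have unit: "(\<integral>x. f x \<partial>rep) = L f"
    if fc: "continuous_on UNIV f" and f: "\<And>x. 0 \<le> f x" "\<And>x. f x \<le> 1" for f
  proof (rule antisym)
    have "L (\<lambda>x. 1 - f x) \<le> (\<integral>x. 1 - f x \<partial>rep)"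
      using that by (intro L_le_integral_unit continuous_intros) auto
    then show "(\<integral>x. f x \<partial>rep) \<le> L f"
      using L_diff[of "\<lambda>_. 1" f] integrable_rep[OF fc] fc L_one
      by (simp add: rep.prob_space[simplified])
  qed (use that in \<open>intro L_le_integral_unit\<close>)
  have "bounded (range f)"
    using fc compact_space by (intro compact_imp_bounded compact_continuous_image)
  then obtain B where B: "\<And>x. norm (f x) \<le> B" "0 < B" by (auto simp: bounded_pos)
  define g where "g x = (f x + B) / (2 * B)" for x
  have gc: "continuous_on UNIV g" unfolding g_def using B by (intro continuous_intros) auto
  have g: "0 \<le> g x" "g x \<le> 1" for x
    using B(1)[of x] B(2) by (auto simp: g_def abs_le_iff)
  have f_eq: "f = (\<lambda>x. 2 * B * g x - B)" using B(2) by (auto simp: g_def field_simps)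
  have "(\<integral>x. f x \<partial>rep) = 2 * B * (\<integral>x. g x \<partial>rep) - B"
    using integrable_rep[OF gc] by (subst f_eq) (simp add: rep.prob_space[simplified])
  also have "\<dots> = L (\<lambda>x. 2 * B * g x - B)"
    using gc unit[OF gc g] L_diff[of "\<lambda>x. 2 * B * g x" "\<lambda>_. B"]
    by (simp add: L_scale L_const continuous_intros)
  finally show ?thesis by (simp flip: f_eq)
qed

lemma rep_in_borel_probs: "rep \<in> borel_probs"
  by (simp add: space_prob_algebra rep.prob_space_axioms)

end

subsection \<open>The pointwise ergodic theorem\<close>

definition birkhoff_average :: "('a \<Rightarrow> 'a) \<Rightarrow> ('a \<Rightarrow> real) \<Rightarrow> 'a \<Rightarrow> nat \<Rightarrow> real" where
  "birkhoff_average T f x n = (\<Sum>i<n. f ((T ^^ i) x)) / real n"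

lemma birkhoff_average_bound:
  assumes "\<And>x. \<bar>f x\<bar> \<le> B"
  shows "\<bar>birkhoff_average T f x n\<bar> \<le> B"
proof (cases "n = 0")
  \<comment> \<open>Division by zero makes this average 0, so only \<open>0 \<le> B\<close> has to
    be shown; the bound at \<open>x\<close> yields it.\<close>
  case True
  have "0 \<le> \<bar>f x\<bar>" by simp
  also have "\<dots> \<le> B" by (rule assms)
  finally show ?thesis using True by (simp add: birkhoff_average_def)
next
  case False
  have "\<bar>\<Sum>i<n. f ((T ^^ i) x)\<bar> \<le> (\<Sum>i<n. \<bar>f ((T ^^ i) x)\<bar>)" by (rule sum_abs)
  also have "\<dots> \<le> (\<Sum>i<n. B)" by (intro sum_mono assms)
  finally show ?thesis using False by (simp add: birkhoff_average_def field_simps)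
qed

lemma birkhoff_average_shift:
  "birkhoff_average T f (T x) n - birkhoff_average T f x n = (f ((T ^^ n) x) - f x) / real n"
proof -
  have "(\<Sum>i<n. f ((T ^^ i) (T x))) - (\<Sum>i<n. f ((T ^^ i) x)) = (\<Sum>i<n. f ((T ^^ Suc i) x) - f ((T ^^ i) x))"
    by (simp add: sum_subtractf funpow_swap1)
  also have "\<dots> = f ((T ^^ n) x) - f x" by (subst sum_lessThan_telescope) simp
  finally show ?thesis by (simp add: birkhoff_average_def flip: diff_divide_distrib)
qed

lemma birkhoff_average_shift_tendsto:
  assumes "\<And>x. \<bar>f x\<bar> \<le> B"
  shows "(\<lambda>n. birkhoff_average T f (T x) n - birkhoff_average T f x n) \<longlonglongrightarrow> 0"
proof (rule Lim_null_comparison)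
  have *: "\<bar>f ((T ^^ n) x) - f x\<bar> \<le> 2 * B" for n
    using assms[of "(T ^^ n) x"] assms[of x] by linarith
  show "\<forall>\<^sub>F n in sequentially. norm (birkhoff_average T f (T x) n - birkhoff_average T f x n) \<le> 2 * B / real n"
    unfolding birkhoff_average_shift by (intro always_eventually allI) (simp add: divide_right_mono *)
qed (rule lim_const_over_n)

locale measure_preserving = prob_space M for M :: "'a measure" +
  fixes T :: "'a \<Rightarrow> 'a"
  assumes T_measurable [measurable]: "T \<in> measurable M M"
    and T_preserves: "distr M M T = M"
begin

lemma integral_T:
  fixes f :: "'a \<Rightarrow> real"
  assumes "f \<in> borel_measurable M"
  shows "(\<integral>x. f (T x) \<partial>M) = (\<integral>x. f x \<partial>M)"
  using integral_distr[OF T_measurable assms] T_preserves by simp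

lemma integrable_T:
  fixes f :: "'a \<Rightarrow> real"
  assumes "integrable M f"
  shows "integrable M (\<lambda>x. f (T x))"
  using integrable_distr[OF T_measurable, of f] assms T_preserves by simp

lemma funpow_measurable [measurable]: "(T ^^ i) \<in> measurable M M"
  by (induction i) (auto intro: measurable_comp[OF _ T_measurable] simp: id_def)

lemma integral_funpow:
  fixes f :: "'a \<Rightarrow> real"
  assumes [measurable]: "f \<in> borel_measurable M"
  shows "(\<integral>x. f ((T ^^ i) x) \<partial>M) = (\<integral>x. f x \<partial>M)"
proof (induction i)
  case (Suc i)
  have "(\<integral>x. f ((T ^^ i) (T x)) \<partial>M) = (\<integral>x. f ((T ^^ i) x) \<partial>M)"
    by (rule integral_T) measurable
  then show ?case using Suc by (simp add: funpow_swap1)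
qed simp

lemma birkhoff_average_measurable [measurable]:
  assumes [measurable]: "f \<in> borel_measurable M"
  shows "(\<lambda>x. birkhoff_average T f x n) \<in> borel_measurable M"
  unfolding birkhoff_average_def by measurable

lemma integrable_bounded:
  fixes f :: "'a \<Rightarrow> real"
  assumes "f \<in> borel_measurable M" "\<And>x. \<bar>f x\<bar> \<le> B"
  shows "integrable M f"
  using assms by (intro integrable_const_bound[of _ B]) auto

lemma integral_birkhoff_average:
  assumes [measurable]: "f \<in> borel_measurable M" and B: "\<And>x. \<bar>f x\<bar> \<le> B" and n: "0 < n"
  shows "(\<integral>x. birkhoff_average T f x n \<partial>M) = (\<integral>x. f x \<partial>M)"
proof -
  have "integrable M (\<lambda>x. f ((T ^^ i) x))" for i
    by (rule integrable_bounded[of _ B]) (use B in auto)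
  then show ?thesis using n
    by (simp add: birkhoff_average_def integral_funpow)
qed

section \<open>The maximal ergodic inequality\<close>

text \<open>This is the maximum of the orbit sums of \<open>g\<close> from \<open>x\<close> with at
  most \<open>n\<close> terms, the empty sum included. The recursion splits off the first orbit
  point.\<close>

primrec max_sum :: "('a \<Rightarrow> real) \<Rightarrow> nat \<Rightarrow> 'a \<Rightarrow> real" where
  "max_sum g 0 x = 0"
| "max_sum g (Suc n) x = max 0 (g x + max_sum g n (T x))"

lemma max_sum_measurable [measurable]:
  assumes [measurable]: "g \<in> borel_measurable M"
  shows "max_sum g n \<in> borel_measurable M"
  by (induction n) (simp_all del: max_less_iff_conj)

lemma max_sum_nonneg: "0 \<le> max_sum g n x"
  by (cases n) auto

lemma max_sum_mono: "max_sum g n x \<le> max_sum g (Suc n) x"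
proof (induction n arbitrary: x)
  case (Suc n)
  from Suc[of "T x"] show ?case by (auto simp: max_def)
qed simp

lemma max_sum_bound:
  assumes "\<And>x. \<bar>g x\<bar> \<le> B"
  shows "max_sum g n x \<le> real n * B"
proof (induction n arbitrary: x)
  case (Suc n)
  have "0 \<le> B" using assms[of x] by linarith
  then have "0 \<le> (1 + real n) * B" by simp
  with Suc[of "T x"] assms[of x] show ?case by (auto simp: algebra_simps)
qed simp

lemma sum_le_max_sum: "(\<Sum>i<n. g ((T ^^ i) x)) \<le> max_sum g n x"
proof (induction n arbitrary: x)
  case (Suc n)
  have "(\<Sum>i<Suc n. g ((T ^^ i) x)) = g x + (\<Sum>i<n. g ((T ^^ i) (T x)))"
    by (subst sum.lessThan_Suc_shift) (simp add: funpow_swap1)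
  with Suc[of "T x"] show ?case by simp
qed simp

text \<open>Garsia's argument. Where \<open>max_sum g n\<close> is positive, its recursion and
  monotonicity in \<open>n\<close> bound \<open>max_sum g n x - max_sum g n (T x)\<close> by
  \<open>g x\<close>; elsewhere the difference is at most 0. It integrates to 0 by invariance, so
  \<open>h n\<close> has nonnegative integral, and by \<open>pos\<close> the functions
  \<open>h n\<close> converge to \<open>g\<close>.\<close>

lemma maximal_ergodic:
  fixes g :: "'a \<Rightarrow> real"
  assumes g[measurable]: "g \<in> borel_measurable M" and B: "\<And>x. \<bar>g x\<bar> \<le> B"
    and pos: "\<And>x. x \<in> space M \<Longrightarrow> \<exists>n. 0 < (\<Sum>i<n. g ((T ^^ i) x))"
  shows "0 \<le> (\<integral>x. g x \<partial>M)"
proof -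
  define h where "h n x = (if 0 < max_sum g n x then g x else 0)" for n x
  have h_meas[measurable]: "h n \<in> borel_measurable M" for n
    unfolding h_def by measurable
  have "0 \<le> (\<integral>x. h n x \<partial>M)" for n
  proof -
    have int: "integrable M (max_sum g n)"
      by (rule integrable_bounded[of _ "real n * B"])
        (use max_sum_bound[OF B] max_sum_nonneg in auto)
    have "0 = (\<integral>x. max_sum g n x - max_sum g n (T x) \<partial>M)"
      using int integrable_T[OF int] by (simp add: integral_T)
    also have "\<dots> \<le> (\<integral>x. h n x \<partial>M)"
    proof (rule integral_mono)
      show "integrable M (\<lambda>x. max_sum g n x - max_sum g n (T x))"
        using int integrable_T[OF int] by simp
      have "0 \<le> B" using B[of undefined] by linarith
      then show "integrable M (h n)"
        by (intro integrable_bounded[of _ B]) (use B in \<open>auto simp: h_def\<close>)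
      show "max_sum g n x - max_sum g n (T x) \<le> h n x" for x
      proof (cases "0 < max_sum g n x")
        case True
        then obtain m where "n = Suc m" by (cases n) auto
        with True max_sum_mono[of g m "T x"] show ?thesis by (auto simp: h_def max_def split: if_splits)
      next
        case False
        with max_sum_nonneg[of g n] show ?thesis by (simp add: h_def antisym_conv2)
      qed
    qed
    finally show ?thesis .
  qed
  moreover have "(\<lambda>n. \<integral>x. h n x \<partial>M) \<longlonglongrightarrow> (\<integral>x. g x \<partial>M)"
  proof (rule integral_dominated_convergence[where w = "\<lambda>_. B"])
    show "AE x in M. (\<lambda>n. h n x) \<longlonglongrightarrow> g x"
    proof (rule AE_I2)
      fix x assume "x \<in> space M"
      from pos[OF this] obtain n where "0 < (\<Sum>i<n. g ((T ^^ i) x))" ..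
      with sum_le_max_sum[of g x n] have n: "0 < max_sum g n x" by linarith
      have "0 < max_sum g m x" if "n \<le> m" for m
        using lift_Suc_mono_le[of "\<lambda>n. max_sum g n x", OF max_sum_mono that] n by linarith
      then have "\<forall>\<^sub>F m in sequentially. h m x = g x"
        by (intro eventually_sequentiallyI[of n]) (simp add: h_def)
      then show "(\<lambda>n. h n x) \<longlonglongrightarrow> g x" by (rule tendsto_eventually)
    qed
    show "AE x in M. norm (h n x) \<le> B" for n
      using B order_trans[OF abs_ge_zero B] by (auto simp: h_def)
  qed auto
  ultimately show ?thesis by (intro LIMSEQ_le_const[where a = 0]) auto
qed

section \<open>Upper time averages and almost everywhere convergence\<close>

definition limsup_average :: "('a \<Rightarrow> real) \<Rightarrow> 'a \<Rightarrow> real" where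
  "limsup_average f x = real_of_ereal (limsup (\<lambda>n. ereal (birkhoff_average T f x n)))"

lemma limsup_average:
  assumes "\<And>x. \<bar>f x\<bar> \<le> B"
  shows "ereal (limsup_average f x) = limsup (\<lambda>n. ereal (birkhoff_average T f x n))"
    and "\<bar>limsup_average f x\<bar> \<le> B"
proof -
  have b: "- B \<le> birkhoff_average T f x n \<and> birkhoff_average T f x n \<le> B" for n
    using birkhoff_average_bound[where f = f and T = T and x = x and n = n, OF assms] by linarith
  let ?l = "limsup (\<lambda>n. ereal (birkhoff_average T f x n))"
  have u: "?l \<le> ereal B" using b by (intro Limsup_bounded always_eventually) auto
  have "ereal (- B) \<le> liminf (\<lambda>n. ereal (birkhoff_average T f x n))"
    using b by (intro Liminf_bounded always_eventually) auto
  also have "\<dots> \<le> ?l" by (rule Liminf_le_Limsup) simp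
  finally have l: "ereal (- B) \<le> ?l" .
  then have fin: "\<bar>?l\<bar> \<noteq> \<infinity>" using u by (cases ?l) auto
  then show "ereal (limsup_average f x) = ?l" by (simp add: limsup_average_def ereal_real')
  with u l have "ereal (limsup_average f x) \<le> ereal B" "ereal (- B) \<le> ereal (limsup_average f x)" by simp_all
  then show "\<bar>limsup_average f x\<bar> \<le> B" by auto
qed

lemma limsup_average_measurable [measurable]:
  assumes [measurable]: "f \<in> borel_measurable M"
  shows "limsup_average f \<in> borel_measurable M"
  unfolding limsup_average_def by measurable

text \<open>The averages at \<open>T x\<close> and at \<open>x\<close> differ by a null sequence.
  The equality holds at every point, so \<open>limsup_average f\<close> is constant along each
  orbit.\<close>

lemma limsup_average_T:
  assumes B: "\<And>x. \<bar>f x\<bar> \<le> B"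
  shows "limsup_average f (T x) = limsup_average f x"
proof -
  let ?d = "\<lambda>n. birkhoff_average T f (T x) n - birkhoff_average T f x n"
  have "(\<lambda>n. ereal (?d n)) \<longlonglongrightarrow> 0"
    using birkhoff_average_shift_tendsto[where f = f and T = T and x = x, OF B] by (simp add: zero_ereal_def)
  from ereal_limsup_lim_add[OF this, of "\<lambda>n. ereal (birkhoff_average T f x n)"]
  have "limsup (\<lambda>n. ereal (birkhoff_average T f (T x) n)) = limsup (\<lambda>n. ereal (birkhoff_average T f x n))"
    by simp
  then show ?thesis by (simp add: limsup_average_def)
qed

text \<open>Since \<open>limsup_average f\<close> is invariant, the sums of \<open>f - limsup_average f + e\<close> become
  positive along every orbit.\<close>

lemma integral_limsup_average_le:
  assumes [measurable]: "f \<in> borel_measurable M" and B: "\<And>x. \<bar>f x\<bar> \<le> B"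
  shows "(\<integral>x. limsup_average f x \<partial>M) \<le> (\<integral>x. f x \<partial>M)"
proof (rule field_le_epsilon)
  fix e :: real assume e: "0 < e"
  let ?s = "limsup_average f"
  define g where "g x = f x - ?s x + e" for x
  have [measurable]: "g \<in> borel_measurable M" unfolding g_def by measurable
  have s_funpow: "?s ((T ^^ i) x) = ?s x" for i x
    by (induction i) (simp_all add: limsup_average_T[OF B])
  have "0 \<le> (\<integral>x. g x \<partial>M)"
  proof (rule maximal_ergodic)
    show "\<bar>g x\<bar> \<le> 2 * B + e" for x
      using B[of x] limsup_average(2)[where f = f and x = x, OF B] e by (simp add: g_def abs_le_iff)
    show "\<exists>n. 0 < (\<Sum>i<n. g ((T ^^ i) x))" for x
    proof (rule ccontr)
      assume "\<nexists>n. 0 < (\<Sum>i<n. g ((T ^^ i) x))"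
      then have neg: "(\<Sum>i<n. g ((T ^^ i) x)) \<le> 0" for n by (simp add: not_less)
      \<comment> \<open>Nonpositive sums of \<open>g\<close> push all averages of \<open>f\<close>
        at \<open>x\<close> to at most \<open>?s x - e\<close>. Their limsup is \<open>?s x\<close>,
        a contradiction.\<close>
      have "birkhoff_average T f x n \<le> ?s x - e" if "0 < n" for n
        using neg[of n] that
        by (simp add: g_def sum.distrib sum_subtractf s_funpow birkhoff_average_def field_simps)
      then have "limsup (\<lambda>n. ereal (birkhoff_average T f x n)) \<le> ereal (?s x - e)"
        by (intro Limsup_bounded eventually_sequentiallyI[of 1]) auto
      then show False using e by (simp flip: limsup_average(1)[OF B])
    qed
  qed measurable
  also have "(\<integral>x. g x \<partial>M) = (\<integral>x. f x \<partial>M) - (\<integral>x. ?s x \<partial>M) + e"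
    using integrable_bounded[of f B] integrable_bounded[of ?s B] B limsup_average(2)[OF B]
    by (simp add: g_def prob_space)
  finally show "(\<integral>x. ?s x \<partial>M) \<le> (\<integral>x. f x \<partial>M) + e" by simp
qed

text \<open>The lower average of \<open>f\<close> is minus the upper average \<open>?t\<close> of
  \<open>- f\<close>. So \<open>?s + ?t\<close> is the gap between upper and lower average: it is
  nonnegative, and \<open>integral_limsup_average_le\<close> for \<open>f\<close> and
  \<open>- f\<close> makes its integral at most 0.\<close>

lemma birkhoff_convergent:
  assumes [measurable]: "f \<in> borel_measurable M" and B: "\<And>x. \<bar>f x\<bar> \<le> B"
  shows "AE x in M. convergent (birkhoff_average T f x)"
proof -
  let ?s = "limsup_average f" and ?t = "limsup_average (\<lambda>x. - f x)"
  have B': "\<And>x. \<bar>- f x\<bar> \<le> B" using B by simp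
  have avg_minus: "birkhoff_average T (\<lambda>x. - f x) x n = - birkhoff_average T f x n" for x n
    by (simp add: birkhoff_average_def sum_negf)
  have t: "liminf (\<lambda>n. ereal (birkhoff_average T f x n)) = ereal (- ?t x)" for x
    using ereal_Limsup_uminus[of sequentially "\<lambda>n. ereal (birkhoff_average T f x n)"]
      limsup_average(1)[where f = "\<lambda>x. - f x" and x = x, OF B']
    by (simp add: avg_minus) (metis ereal_uminus_uminus uminus_ereal.simps(1))
  have int: "integrable M ?s" "integrable M ?t"
    using integrable_bounded[of ?s B] integrable_bounded[of ?t B]
      limsup_average(2)[OF B] limsup_average(2)[OF B'] by auto
  have nonneg: "0 \<le> ?s x + ?t x" for x
  proof -
    have "ereal (- ?t x) \<le> ereal (?s x)"
      unfolding t[symmetric] limsup_average(1)[OF B] by (rule Liminf_le_Limsup) simp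
    then show ?thesis by simp
  qed
  have "(\<integral>x. ?s x + ?t x \<partial>M) \<le> 0"
    using integral_limsup_average_le[OF assms] integral_limsup_average_le[of "\<lambda>x. - f x" B] B int
    by simp
  then have "(\<integral>x. ?s x + ?t x \<partial>M) = 0"
    using nonneg by (intro antisym) (auto intro: integral_nonneg)
  then have "AE x in M. ?s x + ?t x = 0"
    using integral_nonneg_eq_0_iff_AE[of M "\<lambda>x. ?s x + ?t x"] int nonneg by auto
  then show ?thesis
  proof (rule AE_mp, intro AE_I2 impI)
    fix x assume "?s x + ?t x = 0"
    then have "ereal (- ?t x) = ereal (?s x)" by simp
    then have "(\<lambda>n. ereal (birkhoff_average T f x n)) \<longlonglongrightarrow> ereal (?s x)"
      using t[of x] limsup_average(1)[where f = f and x = x, OF B] by (subst tendsto_iff_Liminf_eq_Limsup) simp_all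
    then show "convergent (birkhoff_average T f x)" by (auto simp: convergent_def)
  qed
qed

end

subsection \<open>Probability measures in the weak topology\<close>

lemma borel_probsD:
  assumes "\<mu> \<in> borel_probs"
  shows "prob_space \<mu>" "sets \<mu> = sets borel" "space \<mu> = UNIV"
proof -
  show "prob_space \<mu>" and *: "sets \<mu> = sets borel" using assms by (auto simp: space_prob_algebra)
  show "space \<mu> = UNIV" using sets_eq_imp_space_eq[OF *] by simp
qed

lemma borel_probs_measurable:
  "\<mu> \<in> borel_probs \<Longrightarrow> borel_measurable \<mu> = borel_measurable borel"
  using borel_probsD(2) measurable_cong_sets by blast

lemma borel_probs_integrable:
  fixes f :: "'a::topological_space \<Rightarrow> real"
  assumes "\<mu> \<in> borel_probs" "f \<in> borel_measurable borel" "\<And>x. \<bar>f x\<bar> \<le> B"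
  shows "integrable \<mu> f"
proof -
  interpret prob_space \<mu> using assms(1) by (rule borel_probsD)
  show ?thesis using assms
    by (intro integrable_const_bound[of _ B]) (auto simp: borel_probs_measurable)
qed

lemma compact_space_continuous_bounded:
  fixes f :: "'a::topological_space \<Rightarrow> real"
  assumes "compact (UNIV :: 'a set)" "continuous_on UNIV f"
  obtains B where "\<And>x. \<bar>f x\<bar> \<le> B"
proof -
  have "bounded (range f)"
    using assms by (intro compact_imp_bounded compact_continuous_image)
  then obtain B where "\<And>x. norm (f x) \<le> B" by (auto simp: bounded_iff)
  then show ?thesis using that by auto
qed

lemma continuous_integrable:
  fixes f :: "'a::topological_space \<Rightarrow> real"
  assumes "compact (UNIV :: 'a set)" "continuous_on UNIV f" "\<mu> \<in> borel_probs"
  shows "integrable \<mu> f"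
  using compact_space_continuous_bounded[OF assms(1,2)] borel_probs_integrable[OF assms(3)]
    borel_measurable_continuous_onI[OF assms(2)] by metis

lemma integral_cong_dist:
  fixes f g :: "'a::topological_space \<Rightarrow> real"
  assumes "\<mu> \<in> borel_probs" "integrable \<mu> f" "integrable \<mu> g" "\<And>x. \<bar>f x - g x\<bar> \<le> e"
  shows "\<bar>(\<integral>x. f x \<partial>\<mu>) - (\<integral>x. g x \<partial>\<mu>)\<bar> \<le> e"
proof -
  interpret prob_space \<mu> using assms(1) by (rule borel_probsD)
  have "\<bar>(\<integral>x. f x \<partial>\<mu>) - (\<integral>x. g x \<partial>\<mu>)\<bar> = \<bar>\<integral>x. f x - g x \<partial>\<mu>\<bar>" using assms by simp
  also have "\<dots> \<le> (\<integral>x. \<bar>f x - g x\<bar> \<partial>\<mu>)" by (rule integral_abs_bound)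
  also have "\<dots> \<le> (\<integral>x. e \<partial>\<mu>)" using assms by (intro integral_mono) auto
  finally show ?thesis by (simp add: prob_space)
qed

text \<open>With \<open>d\<close> positive exactly off \<open>C\<close>, the function
  \<open>max 0 (1 - n * d x)\<close> is 1 on \<open>C\<close>, and at every other point it is
  eventually 0.\<close>

lemma closed_indicator_limit:
  fixes C :: "'a::metric_space set"
  assumes "closed C"
  obtains F :: "nat \<Rightarrow> 'a \<Rightarrow> real" where "\<And>n. continuous_on UNIV (F n)"
    "\<And>n x. \<bar>F n x\<bar> \<le> 1" "\<And>x. (\<lambda>n. F n x) \<longlonglongrightarrow> indicator C x"
proof -
  obtain d :: "'a \<Rightarrow> real" where d: "continuous_on UNIV d" "\<And>x. 0 \<le> d x" "\<And>x. 0 < d x \<longleftrightarrow> x \<in> - C"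
    using open_positivity_function[of "- C"] assms by (metis open_Compl)
  show ?thesis
  proof (rule that[of "\<lambda>n x. max 0 (1 - real n * d x)"])
    show "continuous_on UNIV (\<lambda>x. max 0 (1 - real n * d x))" for n
      using d(1) by (intro continuous_intros)
    show "\<bar>max 0 (1 - real n * d x)\<bar> \<le> 1" for n x using d(2)[of x] by simp
    show "(\<lambda>n. max 0 (1 - real n * d x)) \<longlonglongrightarrow> indicator C x" for x
    proof (cases "x \<in> C")
      case True
      then have "d x = 0" using d(2,3)[of x] by auto
      then show ?thesis using True by simp
    next
      case False
      then have "0 < d x" using d(3) by simp
      then obtain N :: nat where N: "1 < real N * d x" using reals_Archimedean3 by blast
      have "max 0 (1 - real n * d x) = 0" if "N \<le> n" for n
      proof -
        have "real N * d x \<le> real n * d x" using that \<open>0 < d x\<close> by (intro mult_right_mono) auto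
        then show ?thesis using N by simp
      qed
      then have "\<forall>\<^sub>F n in sequentially. max 0 (1 - real n * d x) = 0"
        by (rule eventually_sequentiallyI)
      then show ?thesis using False by (simp add: tendsto_eventually)
    qed
  qed
qed

lemma integral_closed_indicator_limit:
  fixes F :: "nat \<Rightarrow> 'a::topological_space \<Rightarrow> real"
  assumes "\<mu> \<in> borel_probs" "closed C" "\<And>n. continuous_on UNIV (F n)"
    "\<And>n x. \<bar>F n x\<bar> \<le> 1" "\<And>x. (\<lambda>n. F n x) \<longlonglongrightarrow> indicator C x"
  shows "(\<lambda>n. \<integral>x. F n x \<partial>\<mu>) \<longlonglongrightarrow> measure \<mu> C"
proof -
  interpret prob_space \<mu> using assms(1) by (rule borel_probsD)
  have C: "C \<in> sets \<mu>" using assms(1,2) by (simp add: borel_probsD)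
  have "(\<lambda>n. \<integral>x. F n x \<partial>\<mu>) \<longlonglongrightarrow> (\<integral>x. indicator C x \<partial>\<mu>)"
    using C assms
    by (intro integral_dominated_convergence[where w = "\<lambda>_. 1"])
      (auto simp: borel_probs_measurable borel_measurable_continuous_onI)
  then show ?thesis using C by simp
qed

lemma borel_eq_closed_sets: "sets borel = sigma_sets UNIV (Collect closed)"
  by (subst borel_eq_closed) simp

lemma Int_stable_closed: "Int_stable (Collect closed)"
  by (auto simp: Int_stable_def)

text \<open>Closed sets form an intersection-stable generator of the Borel sets, and their measures
  are limits of integrals of continuous functions. Uniqueness of weak limits rests on this.\<close>

lemma borel_probs_eqI:
  fixes \<mu> \<nu> :: "'a::metric_space measure"
  assumes \<mu>: "\<mu> \<in> borel_probs" and \<nu>: "\<nu> \<in> borel_probs"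
    and eq: "\<And>f :: 'a \<Rightarrow> real. continuous_on UNIV f \<Longrightarrow> (\<integral>x. f x \<partial>\<mu>) = (\<integral>x. f x \<partial>\<nu>)"
  shows "\<mu> = \<nu>"
proof -
  interpret \<mu>: prob_space \<mu> using \<mu> by (rule borel_probsD)
  interpret \<nu>: prob_space \<nu> using \<nu> by (rule borel_probsD)
  show ?thesis
  proof (rule measure_eqI_generator_eq[where E = "Collect closed" and \<Omega> = UNIV and A = "\<lambda>_. UNIV"])
    fix C :: "'a set" assume "C \<in> Collect closed"
    then have C: "closed C" by simp
    obtain F :: "nat \<Rightarrow> 'a \<Rightarrow> real" where F: "\<And>n. continuous_on UNIV (F n)"
      "\<And>n x. \<bar>F n x\<bar> \<le> 1" "\<And>x. (\<lambda>n. F n x) \<longlonglongrightarrow> indicator C x"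
      using closed_indicator_limit[OF C] by blast
    have "measure \<mu> C = measure \<nu> C"
      using integral_closed_indicator_limit[OF \<mu> C F] integral_closed_indicator_limit[OF \<nu> C F]
      by (simp add: eq[OF F(1)] LIMSEQ_unique)
    then show "emeasure \<mu> C = emeasure \<nu> C"
      by (simp add: \<mu>.emeasure_eq_measure \<nu>.emeasure_eq_measure)
  qed (use \<mu> \<nu> Int_stable_closed in \<open>auto simp: borel_probsD borel_eq_closed_sets\<close>)
qed

section \<open>Kernels and mixtures of measures\<close>

text \<open>Evaluation at a closed set is a pointwise limit of integrals of continuous functions,
  hence measurable. Evaluations at the closed sets suffice, because these are an intersection-stable
  generator.\<close>

lemma kernel_measurable:
  fixes K :: "'b \<Rightarrow> 'a::metric_space measure"
  assumes K: "\<And>x. x \<in> space M \<Longrightarrow> K x \<in> borel_probs"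
    and meas: "\<And>f :: 'a \<Rightarrow> real. continuous_on UNIV f \<Longrightarrow> (\<lambda>x. \<integral>y. f y \<partial>K x) \<in> borel_measurable M"
  shows "K \<in> measurable M (subprob_algebra borel)"
proof (rule measurable_subprob_algebra_generated[where \<Omega> = UNIV and G = "Collect closed"])
  show "subprob_space (K x)" if "x \<in> space M" for x
    using borel_probsD(1)[OF K[OF that]] by (rule prob_space_imp_subprob_space)
  show closed: "(\<lambda>x. emeasure (K x) C) \<in> borel_measurable M" if "C \<in> Collect closed" for C
  proof -
    from that have C: "closed C" by simp
    obtain F :: "nat \<Rightarrow> 'a \<Rightarrow> real" where F: "\<And>n. continuous_on UNIV (F n)"
      "\<And>n x. \<bar>F n x\<bar> \<le> 1" "\<And>x. (\<lambda>n. F n x) \<longlonglongrightarrow> indicator C x"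
      using closed_indicator_limit[OF C] by blast
    have "(\<lambda>x. measure (K x) C) \<in> borel_measurable M"
      by (rule borel_measurable_LIMSEQ_real[where u = "\<lambda>n x. \<integral>y. F n y \<partial>K x"])
        (use integral_closed_indicator_limit[OF K C F] meas[OF F(1)] in auto)
    then have "(\<lambda>x. ennreal (measure (K x) C)) \<in> borel_measurable M" by measurable
    then show ?thesis
      by (rule measurable_cong[THEN iffD1, rotated])
        (use borel_probsD(1)[OF K] in \<open>simp add: finite_measure.emeasure_eq_measure prob_space.finite_measure\<close>)
  qed
  show "(\<lambda>x. emeasure (K x) UNIV) \<in> borel_measurable M" by (rule closed) simp
qed (use K Int_stable_closed in \<open>auto simp: borel_probsD borel_eq_closed_sets\<close>)

text \<open>The mixture of the measures \<open>K x\<close> over \<open>N\<close> is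
  \<open>join ?D\<close>. By \<open>eq\<close> it has the same continuous integrals as
  \<open>\<mu>\<close>, so the two measures coincide, and the formula for integrals against a
  mixture applies to every bounded Borel \<open>f\<close>.\<close>

lemma integral_kernel:
  fixes K :: "'b \<Rightarrow> 'a::metric_space measure" and f :: "'a \<Rightarrow> real"
  assumes compact: "compact (UNIV :: 'a set)" and N: "prob_space N" and \<mu>: "\<mu> \<in> borel_probs"
    and K: "\<And>x. x \<in> space N \<Longrightarrow> K x \<in> borel_probs"
    and meas: "K \<in> measurable N (subprob_algebra borel)"
    and eq: "\<And>f :: 'a \<Rightarrow> real. continuous_on UNIV f \<Longrightarrow>
      (\<integral>x. f x \<partial>\<mu>) = (\<integral>x. (\<integral>y. f y \<partial>K x) \<partial>N)"
    and f: "f \<in> borel_measurable borel" "\<And>x. \<bar>f x\<bar> \<le> B"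
  shows "(\<integral>x. f x \<partial>\<mu>) = (\<integral>x. (\<integral>y. f y \<partial>K x) \<partial>N)"
proof -
  interpret N: prob_space N by fact
  note [measurable] = meas f(1)
  have K_prob: "prob_space (K x)" if "x \<in> space N" for x using K[OF that] by (rule borel_probsD)
  let ?D = "distr N (subprob_algebra borel) K"
  have D: "prob_space ?D" using meas by (rule N.prob_space_distr)
  have join: "(\<integral>x. g x \<partial>join ?D) = (\<integral>x. (\<integral>y. g y \<partial>K x) \<partial>N)"
    if [measurable]: "g \<in> borel_measurable borel" and B: "\<And>x. \<bar>g x\<bar> \<le> B" for g :: "'a \<Rightarrow> real" and B
  proof -
    have "(\<integral>x. g x \<partial>join ?D) = (\<integral>M'. (\<integral>y. g y \<partial>M') \<partial>?D)"
    proof (rule integral_join[where B = B and B' = 1 and N = borel])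
      show "finite_measure ?D" using D by (rule prob_space.finite_measure)
      show "AE M' in ?D. emeasure M' (space M') \<le> ennreal 1"
        by (subst AE_distr_iff) (auto intro!: AE_I2 simp: prob_space.emeasure_space_1 K_prob)
    qed (use B in auto)
    also have "\<dots> = (\<integral>x. (\<integral>y. g y \<partial>K x) \<partial>N)" by (rule integral_distr) measurable
    finally show ?thesis .
  qed
  have "emeasure (join ?D) UNIV = (\<integral>\<^sup>+x. emeasure (K x) UNIV \<partial>N)"
    by (subst emeasure_join) (auto simp: nn_integral_distr)
  also have "\<dots> = (\<integral>\<^sup>+x. 1 \<partial>N)"
    using K_prob borel_probsD(3)[OF K] by (intro nn_integral_cong) (metis prob_space.emeasure_space_1)
  finally have "emeasure (join ?D) UNIV = 1" by (simp add: N.emeasure_space_1)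
  then have "join ?D \<in> borel_probs"
    by (auto simp: space_prob_algebra space_join intro!: prob_spaceI)
  then have "\<mu> = join ?D"
  proof (rule borel_probs_eqI[OF \<mu>])
    fix f :: "'a \<Rightarrow> real" assume "continuous_on UNIV f"
    then show "(\<integral>x. f x \<partial>\<mu>) = (\<integral>x. f x \<partial>join ?D)"
      using compact_space_continuous_bounded[OF compact] join borel_measurable_continuous_onI eq by metis
  qed
  then show "(\<integral>x. f x \<partial>\<mu>) = (\<integral>x. (\<integral>y. f y \<partial>K x) \<partial>N)" using join[OF f] by simp
qed

section \<open>A countable family of continuous functions with dense span\<close>

text \<open>For each \<open>m\<close>, take a partition of unity subordinate to the balls of radius
  \<open>1 / (m + 1)\<close> around a finite net. Weighting it by the values of \<open>f\<close> at
  the net points approximates \<open>f\<close>, once the radius is below the modulus of uniform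
  continuity.\<close>

lemma countable_dense_span:
  assumes "compact (UNIV :: 'a::metric_space set)"
  obtains g :: "nat \<Rightarrow> 'a::metric_space \<Rightarrow> real" where "\<And>k. continuous_on UNIV (g k)"
    "\<And>f e. continuous_on UNIV f \<Longrightarrow> 0 < e \<Longrightarrow>
      \<exists>I c. finite I \<and> (\<forall>x. \<bar>f x - (\<Sum>k\<in>I. c k * g k x)\<bar> \<le> e)"
proof -
  let ?r = "\<lambda>m. 1 / real (Suc m)"
  have "\<exists>xs :: 'a list. UNIV \<subseteq> (\<Union>a\<in>set xs. ball a (?r m))" for m
  proof -
    obtain A :: "'a set" where "finite A" "UNIV \<subseteq> (\<Union>a\<in>A. ball a (?r m))"
      using assms by (auto simp: compact_eq_totally_bounded dest!: spec[of _ "?r m"])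
    then show ?thesis using finite_list by metis
  qed
  then obtain net :: "nat \<Rightarrow> 'a list" where net: "\<And>m. UNIV \<subseteq> (\<Union>a\<in>set (net m). ball a (?r m))"
    by metis
  define \<phi> where "\<phi> m i x = max 0 (?r m - dist x (net m ! i))" for m i x
  define s where "s m x = (\<Sum>i<length (net m). \<phi> m i x)" for m x
  \<comment> \<open>The code \<open>k\<close> enumerates pairs \<open>(m, i)\<close>. An index
    \<open>i\<close> beyond the net refers to an unspecified point, which is harmless: the function
    is continuous all the same, and the approximation uses only genuine indices.\<close>
  define g where "g k = (\<lambda>(m, i) x. \<phi> m i x / s m x) (prod_decode k)" for k
  have \<phi>_cont: "continuous_on UNIV (\<phi> m i)" for m i
    unfolding \<phi>_def by (intro continuous_intros)
  have \<phi>0: "0 \<le> \<phi> m i x" for m i x by (simp add: \<phi>_def)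
  have s_pos: "0 < s m x" for m x
  proof -
    obtain i where "i < length (net m)" "x \<in> ball (net m ! i) (?r m)"
      using net[of m] by (fastforce simp: in_set_conv_nth)
    then have "0 < \<phi> m i x" "i < length (net m)" by (auto simp: \<phi>_def dist_commute)
    then show ?thesis unfolding s_def using \<phi>0 by (intro sum_pos2[of _ i]) auto
  qed
  have s_ne: "s m x \<noteq> 0" for m x using s_pos[of m x] by simp
  have s_cont: "continuous_on UNIV (s m)" for m
    unfolding s_def by (intro continuous_intros \<phi>_cont)
  show ?thesis
  proof (rule that)
    show "continuous_on UNIV (g k)" for k
      unfolding g_def using \<phi>_cont s_cont s_ne
      by (auto split: prod.split intro!: continuous_on_divide)
    fix f :: "'a \<Rightarrow> real" and e :: real
    assume f: "continuous_on UNIV f" and e: "0 < e"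
    have "uniformly_continuous_on UNIV f" using f assms by (rule compact_uniformly_continuous)
    then obtain d where d: "0 < d" "\<And>x y. dist x y < d \<Longrightarrow> dist (f x) (f y) < e"
      using e unfolding uniformly_continuous_on_def by (metis UNIV_I)
    obtain m where m: "?r m < d" using d(1) nat_approx_posE by metis
    let ?n = "length (net m)"
    define I where "I = (\<lambda>i. prod_encode (m, i)) ` {..<?n}"
    define c where "c k = f (net m ! snd (prod_decode k))" for k
    have "\<bar>f x - (\<Sum>k\<in>I. c k * g k x)\<bar> \<le> e" for x
    proof -
      have "(\<Sum>k\<in>I. c k * g k x) = (\<Sum>i<?n. f (net m ! i) * (\<phi> m i x / s m x))"
        unfolding I_def by (subst sum.reindex) (auto simp: inj_on_def c_def g_def)
      moreover have sum1: "(\<Sum>i<?n. \<phi> m i x / s m x) = 1"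
        using s_ne[of m x] by (simp add: s_def flip: sum_divide_distrib)
      ultimately have "f x - (\<Sum>k\<in>I. c k * g k x) = (\<Sum>i<?n. (f x - f (net m ! i)) * (\<phi> m i x / s m x))"
        by (simp add: left_diff_distrib sum_subtractf flip: sum_distrib_left del: times_divide_eq_right)
      also have "\<bar>\<dots>\<bar> \<le> (\<Sum>i<?n. \<bar>(f x - f (net m ! i)) * (\<phi> m i x / s m x)\<bar>)"
        by (rule sum_abs)
      also have "\<dots> \<le> (\<Sum>i<?n. e * (\<phi> m i x / s m x))"
      proof (rule sum_mono)
        fix i
        show "\<bar>(f x - f (net m ! i)) * (\<phi> m i x / s m x)\<bar> \<le> e * (\<phi> m i x / s m x)"
        proof (cases "\<phi> m i x = 0")
          \<comment> \<open>A nonzero weight at \<open>x\<close> means that the net point is closer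
            than \<open>1 / (m + 1)\<close>, so \<open>f\<close> differs there from
            \<open>f x\<close> by less than \<open>e\<close>.\<close>
          case False
          then have "dist x (net m ! i) < d" using m by (auto simp: \<phi>_def max_def split: if_splits)
          then have "\<bar>f x - f (net m ! i)\<bar> \<le> e" using d(2) by (force simp: dist_real_def)
          moreover have "0 \<le> \<phi> m i x / s m x" using \<phi>0 s_pos by (simp add: less_imp_le)
          ultimately show ?thesis unfolding abs_mult by (intro mult_mono) auto
        qed simp
      qed
      also have "\<dots> = e" using sum1 by (simp flip: sum_distrib_left del: times_divide_eq_right)
      finally show ?thesis .
    qed
    moreover have "finite I" by (simp add: I_def)
    ultimately show "\<exists>I c. finite I \<and> (\<forall>x. \<bar>f x - (\<Sum>k\<in>I. c k * g k x)\<bar> \<le> e)" by blast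
  qed
qed

section \<open>Weak convergence and weakly open sets\<close>

lemma openin_weak_topology_integral:
  fixes f :: "'a::topological_space \<Rightarrow> real"
  assumes "continuous_on UNIV f" "open U"
  shows "openin weak_topology {\<mu> \<in> borel_probs. (\<integral>x. f x \<partial>\<mu>) \<in> U}"
  unfolding weak_topology_def using assms by (intro topology_generated_by_Basis CollectI exI[of _ f] exI[of _ U] conjI refl)

text \<open>Convergence of integrals handles the subbasic sets, and induction over the generated
  topology handles the rest. Membership in \<open>borel_probs\<close> is asked only eventually, as
  the empirical measure for \<open>n = 0\<close> is the null measure.\<close>

lemma limitin_weak_topology_iff:
  fixes X :: "'b \<Rightarrow> 'a::topological_space measure"
  assumes ev: "\<forall>\<^sub>F n in F. X n \<in> borel_probs"
  shows "limitin weak_topology X \<nu> F \<longleftrightarrow> \<nu> \<in> borel_probs \<and>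
    (\<forall>f :: 'a \<Rightarrow> real. continuous_on UNIV f \<longrightarrow> ((\<lambda>n. \<integral>x. f x \<partial>X n) \<longlongrightarrow> (\<integral>x. f x \<partial>\<nu>)) F)"
    (is "_ \<longleftrightarrow> _ \<and> ?conv")
proof (intro iffI conjI allI impI)
  assume lim: "limitin weak_topology X \<nu> F"
  then show \<nu>: "\<nu> \<in> borel_probs" using limitin_topspace topspace_weak_topology by metis
  fix f :: "'a \<Rightarrow> real" assume f: "continuous_on UNIV f"
  show "((\<lambda>n. \<integral>x. f x \<partial>X n) \<longlongrightarrow> (\<integral>x. f x \<partial>\<nu>)) F"
  proof (rule topological_tendstoI)
    fix U assume "open U" "(\<integral>x. f x \<partial>\<nu>) \<in> U"
    then have "\<forall>\<^sub>F n in F. X n \<in> {\<mu> \<in> borel_probs. (\<integral>x. f x \<partial>\<mu>) \<in> U}"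
      using lim \<nu> openin_weak_topology_integral[OF f] unfolding limitin_def by blast
    then show "\<forall>\<^sub>F n in F. (\<integral>x. f x \<partial>X n) \<in> U" by (rule eventually_mono) simp
  qed
next
  assume R: "\<nu> \<in> borel_probs \<and> ?conv"
  have "\<forall>\<^sub>F n in F. X n \<in> U" if "openin weak_topology U" "\<nu> \<in> U" for U
  proof -
    have "generate_topology_on {{\<mu> \<in> borel_probs. (\<integral>x. f x \<partial>\<mu>) \<in> U} | (f :: 'a \<Rightarrow> real) U.
        continuous_on UNIV f \<and> open U} U"
      using that(1) unfolding weak_topology_def by (rule openin_topology_generated_by)
    then have "\<nu> \<in> U \<longrightarrow> (\<forall>\<^sub>F n in F. X n \<in> U)"
    proof induction
      case (Int a b)
      then show ?case by (auto intro: eventually_conj)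
    next
      case (UN K)
      show ?case
      proof
        assume "\<nu> \<in> \<Union>K"
        then obtain k where "k \<in> K" "\<nu> \<in> k" by blast
        with UN have "\<forall>\<^sub>F n in F. X n \<in> k" by blast
        then show "\<forall>\<^sub>F n in F. X n \<in> \<Union>K" by (rule eventually_mono) (use \<open>k \<in> K\<close> in blast)
      qed
    next
      case (Basis s)
      then obtain f :: "'a \<Rightarrow> real" and U where s: "s = {\<mu> \<in> borel_probs. (\<integral>x. f x \<partial>\<mu>) \<in> U}"
        "continuous_on UNIV f" "open U" by blast
      show ?case
      proof
        assume "\<nu> \<in> s"
        then have "\<forall>\<^sub>F n in F. (\<integral>x. f x \<partial>X n) \<in> U"
          using R s by (auto intro: topological_tendstoD)
        then show "\<forall>\<^sub>F n in F. X n \<in> s" using ev by eventually_elim (simp add: s)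
      qed
    qed simp
    then show ?thesis using that(2) by blast
  qed
  then show "limitin weak_topology X \<nu> F"
    using R by (auto simp: limitin_def topspace_weak_topology)
qed

text \<open>Countably many integrals embed the probability measures into a second countable space,
  which makes every weakly open set accessible to countable operations.\<close>

lemma weakly_open_as_preimage:
  fixes g :: "nat \<Rightarrow> 'a::metric_space \<Rightarrow> real"
  assumes compact: "compact (UNIV :: 'a set)" and g: "\<And>k. continuous_on UNIV (g k)"
    and dense: "\<And>f e. continuous_on UNIV f \<Longrightarrow> 0 < e \<Longrightarrow>
      \<exists>I c. finite I \<and> (\<forall>x. \<bar>f x - (\<Sum>k\<in>I. c k * g k x)\<bar> \<le> e)"
    and U: "openin weak_topology (U :: 'a measure set)"
  shows "\<exists>W. open W \<and> U = {\<mu> \<in> borel_probs. (\<lambda>k. \<integral>x. g k x \<partial>\<mu>) \<in> W}"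
proof -
  let ?\<Phi> = "\<lambda>\<mu> k. \<integral>x. g k x \<partial>\<mu>"
  have "generate_topology_on {{\<mu> \<in> borel_probs. (\<integral>x. f x \<partial>\<mu>) \<in> U} | (f :: 'a \<Rightarrow> real) U.
        continuous_on UNIV f \<and> open U} U"
    using U unfolding weak_topology_def by (rule openin_topology_generated_by)
  then show ?thesis
  proof induction
    case Empty
    then show ?case by (intro exI[of _ "{}"]) auto
  next
    case (Int a b)
    then obtain V W where "open V" "open W" "a = {\<mu> \<in> borel_probs. ?\<Phi> \<mu> \<in> V}" "b = {\<mu> \<in> borel_probs. ?\<Phi> \<mu> \<in> W}"
      by blast
    then show ?case by (intro exI[of _ "V \<inter> W"]) auto
  next
    case (UN \<K>)
    then have "\<forall>k\<in>\<K>. \<exists>W. open W \<and> k = {\<mu> \<in> borel_probs. ?\<Phi> \<mu> \<in> W}" by simp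
    from bchoice[OF this] obtain W
      where W: "\<forall>k\<in>\<K>. open (W k) \<and> k = {\<mu> \<in> borel_probs. ?\<Phi> \<mu> \<in> W k}" ..
    have "\<mu> \<in> k \<longleftrightarrow> \<mu> \<in> borel_probs \<and> ?\<Phi> \<mu> \<in> W k" if "k \<in> \<K>" for \<mu> k
      using W that by blast
    then have "\<Union>\<K> = {\<mu> \<in> borel_probs. ?\<Phi> \<mu> \<in> (\<Union>k\<in>\<K>. W k)}" by auto
    moreover have "open (\<Union>k\<in>\<K>. W k)" using W by (intro open_UN) simp
    ultimately show ?case by blast
  next
    case (Basis s)
    then obtain f :: "'a \<Rightarrow> real" and U where s: "s = {\<mu> \<in> borel_probs. (\<integral>x. f x \<partial>\<mu>) \<in> U}"
      and f: "continuous_on UNIV f" and U: "open U" by blast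
    define approx where "approx I c e \<longleftrightarrow>
      finite I \<and> (\<forall>x. \<bar>f x - (\<Sum>k\<in>I. c k * g k x)\<bar> \<le> e)" for I c e
    \<comment> \<open>The combination stands for the integral of an \<open>e\<close>-approximation
      of \<open>f\<close>. Being within \<open>e\<close> of \<open>y\<close>, it leaves the true
      integral inside the ball of radius \<open>2 * e\<close> around \<open>y\<close>, hence in
      \<open>U\<close>. This makes the union of these open sets no larger than the given
      one.\<close>
    define V where "V I c e = {w. \<exists>y. \<bar>(\<Sum>k\<in>I. c k * w k) - y\<bar> < e \<and> ball y (2 * e) \<subseteq> U}"
      for I :: "nat set" and c e
    have approx_int: "\<bar>(\<integral>x. f x \<partial>\<mu>) - (\<Sum>k\<in>I. c k * ?\<Phi> \<mu> k)\<bar> \<le> e"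
      if \<mu>: "\<mu> \<in> borel_probs" and "approx I c e" for \<mu> I c e
    proof -
      have "integrable \<mu> (g k)" for k by (rule continuous_integrable[OF compact g \<mu>])
      then have int: "integrable \<mu> (\<lambda>x. c k * g k x)" for k by simp
      have "(\<integral>x. (\<Sum>k\<in>I. c k * g k x) \<partial>\<mu>) = (\<Sum>k\<in>I. c k * ?\<Phi> \<mu> k)"
        by (subst Bochner_Integration.integral_sum) (use int in auto)
      moreover have "\<bar>(\<integral>x. f x \<partial>\<mu>) - (\<integral>x. (\<Sum>k\<in>I. c k * g k x) \<partial>\<mu>)\<bar> \<le> e"
        using that int continuous_integrable[OF compact f \<mu>]
        by (intro integral_cong_dist[OF \<mu>]) (auto simp: approx_def)
      ultimately show ?thesis by simp
    qed
    have V: "open (V I c e)" for I c e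
    proof -
      have cont: "continuous_on UNIV (\<lambda>w :: nat \<Rightarrow> real. \<Sum>k\<in>I. c k * w k)"
        by (intro continuous_intros continuous_on_product_coordinates)
      have "V I c e = (\<Union>y\<in>{y. ball y (2 * e) \<subseteq> U}. {w. \<bar>(\<Sum>k\<in>I. c k * w k) - y\<bar> < e})"
        by (auto simp: V_def)
      also have "open \<dots>"
        by (intro open_UN ballI open_Collect_less continuous_intros cont)
      finally show ?thesis .
    qed
    let ?W = "\<Union>(I, c, e)\<in>{(I, c, e). approx I c e}. V I c e"
    have "open ?W" using V by (intro open_UN) auto
    moreover have "s = {\<mu> \<in> borel_probs. ?\<Phi> \<mu> \<in> ?W}"
    proof (intro set_eqI iffI)
      fix \<mu> assume "\<mu> \<in> {\<mu> \<in> borel_probs. ?\<Phi> \<mu> \<in> ?W}"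
      then obtain I c e y where \<mu>: "\<mu> \<in> borel_probs" and a: "approx I c e"
        and y: "\<bar>(\<Sum>k\<in>I. c k * ?\<Phi> \<mu> k) - y\<bar> < e" "ball y (2 * e) \<subseteq> U"
        by (auto simp: V_def)
      have "(\<integral>x. f x \<partial>\<mu>) \<in> ball y (2 * e)"
        using approx_int[OF \<mu> a] y(1) by (simp add: dist_real_def)
      then show "\<mu> \<in> s" using \<mu> y(2) by (auto simp: s)
    next
      fix \<mu> assume "\<mu> \<in> s"
      then have \<mu>: "\<mu> \<in> borel_probs" and "(\<integral>x. f x \<partial>\<mu>) \<in> U" by (auto simp: s)
      then obtain r where r: "0 < r" "ball (\<integral>x. f x \<partial>\<mu>) r \<subseteq> U"
        using U open_contains_ball by blast
      \<comment> \<open>With accuracy \<open>r / 3\<close>, a ball of radius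
        \<open>2 * (r / 3)\<close> around the approximate integral stays within the ball of radius
        \<open>r\<close> around the true one.\<close>
      obtain I c where a: "approx I c (r / 3)"
        using dense[OF f, of "r / 3"] r(1) unfolding approx_def by auto
      let ?y = "\<Sum>k\<in>I. c k * ?\<Phi> \<mu> k"
      have "ball ?y (2 * (r / 3)) \<subseteq> ball (\<integral>x. f x \<partial>\<mu>) r"
      proof
        fix z assume "z \<in> ball ?y (2 * (r / 3))"
        then have "\<bar>?y - z\<bar> < 2 * (r / 3)" by (simp add: dist_real_def)
        with approx_int[OF \<mu> a] have "\<bar>(\<integral>x. f x \<partial>\<mu>) - z\<bar> < r" by linarith
        then show "z \<in> ball (\<integral>x. f x \<partial>\<mu>) r" by (simp add: dist_real_def)
      qed
      then have "?\<Phi> \<mu> \<in> V I c (r / 3)" unfolding V_def using r by (auto intro!: exI[of _ ?y])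
      then show "\<mu> \<in> {\<mu> \<in> borel_probs. ?\<Phi> \<mu> \<in> ?W}" using \<mu> a by auto
    qed
    ultimately show ?case by blast
  qed
qed

lemma ergodic_measures_subset: "ergodic_measures T \<subseteq> invariant_measures T"
  by (auto simp: ergodic_measures_def)

lemma invariant_measures_subset: "invariant_measures T \<subseteq> borel_probs"
  by (auto simp: invariant_measures_def)

section \<open>The Borel structure on the ergodic measures\<close>

text \<open>Every weakly open set is the preimage of an open set of real sequences under countably
  many integrals, and a map into that sequence space is measurable once its coordinates are.\<close>

lemma measurable_ergodic_borelI:
  fixes K :: "'b \<Rightarrow> 'a::metric_space measure"
  assumes compact: "compact (UNIV :: 'a set)"
    and K: "\<And>x. x \<in> space M \<Longrightarrow> K x \<in> ergodic_measures T"
    and meas: "\<And>f :: 'a \<Rightarrow> real. continuous_on UNIV f \<Longrightarrow> (\<lambda>x. \<integral>y. f y \<partial>K x) \<in> borel_measurable M"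
  shows "K \<in> measurable M (ergodic_borel T)"
  unfolding ergodic_borel_def
proof (rule measurable_measure_of)
  show "{U. openin (subtopology weak_topology (ergodic_measures T)) U} \<subseteq> Pow (ergodic_measures T)"
    using openin_subset by fastforce
  show "K \<in> space M \<rightarrow> ergodic_measures T" using K by auto
  fix U assume "U \<in> {U. openin (subtopology weak_topology (ergodic_measures T)) U}"
  then obtain U' where U': "openin weak_topology U'" "U = U' \<inter> ergodic_measures T"
    by (auto simp: openin_subtopology)
  obtain g :: "nat \<Rightarrow> 'a \<Rightarrow> real" where g: "\<And>k. continuous_on UNIV (g k)"
    "\<And>f e. continuous_on UNIV f \<Longrightarrow> 0 < e \<Longrightarrow>
      \<exists>I c. finite I \<and> (\<forall>x. \<bar>f x - (\<Sum>k\<in>I. c k * g k x)\<bar> \<le> e)"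
    using countable_dense_span[OF compact] by blast
  obtain W where W: "open W" "U' = {\<mu> \<in> borel_probs. (\<lambda>k. \<integral>x. g k x \<partial>\<mu>) \<in> W}"
    using weakly_open_as_preimage[OF compact g U'(1)] by blast
  have "(\<lambda>x k. \<integral>y. g k y \<partial>K x) \<in> borel_measurable M"
    by (intro measurable_coordinatewise_then_product meas g)
  then have "(\<lambda>x k. \<integral>y. g k y \<partial>K x) -` W \<inter> space M \<in> sets M"
    using W(1) by (intro measurable_sets) auto
  also have "(\<lambda>x k. \<integral>y. g k y \<partial>K x) -` W \<inter> space M = K -` U \<inter> space M"
    using K ergodic_measures_subset invariant_measures_subset
    by (fastforce simp: U' W)
  finally show "K -` U \<inter> space M \<in> sets M" .
qed

lemma ergodic_borel_integral_measurable:
  fixes f :: "'a::topological_space \<Rightarrow> real"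
  assumes "continuous_on UNIV f"
  shows "(\<lambda>\<nu>. \<integral>x. f x \<partial>\<nu>) \<in> borel_measurable (ergodic_borel T)"
proof (rule borel_measurableI)
  fix U :: "real set" assume "open U"
  from openin_weak_topology_integral[OF assms this]
  have "openin (subtopology weak_topology (ergodic_measures T))
      ({\<mu> \<in> borel_probs. (\<integral>x. f x \<partial>\<mu>) \<in> U} \<inter> ergodic_measures T)"
    by (rule openin_subtopology_Int)
  moreover have "{\<mu> \<in> borel_probs. (\<integral>x. f x \<partial>\<mu>) \<in> U} \<inter> ergodic_measures T =
      (\<lambda>\<nu>. \<integral>x. f x \<partial>\<nu>) -` U \<inter> space (ergodic_borel T)"
    using ergodic_measures_subset invariant_measures_subset
    by (fastforce simp: space_ergodic_borel)
  moreover have "{U. openin (subtopology weak_topology (ergodic_measures T)) U} \<subseteq> Pow (ergodic_measures T)"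
    using openin_subset by fastforce
  ultimately show "(\<lambda>\<nu>. \<integral>x. f x \<partial>\<nu>) -` U \<inter> space (ergodic_borel T) \<in> sets (ergodic_borel T)"
    by (simp add: ergodic_borel_def sets_measure_of)
qed

text \<open>Composition with this map makes \<open>\<nu> \<mapsto> \<integral>f d\<nu>\<close>
  measurable for Borel \<open>f\<close>, whereas the weak topology directly gives this only for
  continuous \<open>f\<close>.\<close>

lemma id_ergodic_borel_measurable:
  "(\<lambda>\<nu> :: 'a::metric_space measure. \<nu>) \<in> measurable (ergodic_borel T) (subprob_algebra borel)"
  by (rule kernel_measurable)
    (use ergodic_measures_subset invariant_measures_subset in
      \<open>fastforce simp: space_ergodic_borel intro: ergodic_borel_integral_measurable\<close>)+

subsection \<open>Limit measures\<close>

lemma integral_empirical_measure: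
  fixes f :: "'a::topological_space \<Rightarrow> real"
  assumes n: "0 < n" and f: "f \<in> borel_measurable borel"
  shows "(\<integral>y. f y \<partial>empirical_measure T x n) = birkhoff_average T f x n"
proof -
  let ?p = "pmf_of_set {..<n}"
  have ne: "{..<n} \<noteq> {}" "finite {..<n}" using n by auto
  have meas: "(\<lambda>i. (T ^^ i) x) \<in> measurable (measure_pmf ?p) borel" by simp
  \<comment> \<open>The empirical measure is the image of the uniform distribution on
    \<open>{..<n}\<close> under \<open>i \<mapsto> (T ^^ i) x\<close>, so integrating against it is
    a finite average.\<close>
  have "empirical_measure T x n = distr (measure_pmf ?p) borel (\<lambda>i. (T ^^ i) x)"
  proof (rule measure_eqI)
    show sets: "sets (empirical_measure T x n) = sets (distr (measure_pmf ?p) borel (\<lambda>i. (T ^^ i) x))"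
      using borel_probsD(2)[OF empirical_measure_in_borel_probs[OF n]] by simp
    fix A assume "A \<in> sets (empirical_measure T x n)"
    then have A: "A \<in> sets borel" using sets by simp
    have "(\<Sum>i<n. indicator A ((T ^^ i) x)) = (of_nat (card ({..<n} \<inter> (\<lambda>i. (T ^^ i) x) -` A)) :: ennreal)"
      by (simp add: indicator_def sum.If_cases vimage_def Collect_conj_eq[symmetric] Int_def)
    then have "emeasure (empirical_measure T x n) A =
        of_nat (card ({..<n} \<inter> (\<lambda>i. (T ^^ i) x) -` A)) / of_nat n"
      using A by (simp add: emeasure_empirical_measure)
    also have "\<dots> = emeasure (measure_pmf ?p) ((\<lambda>i. (T ^^ i) x) -` A)"
      using n by (subst emeasure_pmf_of_set[OF ne])
        (simp add: ennreal_of_nat_eq_real_of_nat divide_ennreal)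
    finally show "emeasure (empirical_measure T x n) A =
        emeasure (distr (measure_pmf ?p) borel (\<lambda>i. (T ^^ i) x)) A"
      using A by (simp add: emeasure_distr)
  qed
  then have "(\<integral>y. f y \<partial>empirical_measure T x n) = (\<integral>i. f ((T ^^ i) x) \<partial>measure_pmf ?p)"
    using integral_distr[OF meas f] by simp
  also have "\<dots> = birkhoff_average T f x n"
    by (subst integral_pmf_of_set[OF ne]) (simp add: birkhoff_average_def)
  finally show ?thesis .
qed

text \<open>Uniform closeness to convergent sequences gives the Cauchy property. This carries
  convergence of averages from the span of the test functions to all continuous functions.\<close>

lemma convergent_approx:
  fixes X :: "nat \<Rightarrow> real"
  assumes "\<And>e. 0 < e \<Longrightarrow> \<exists>Y. convergent Y \<and> (\<forall>n. \<bar>X n - Y n\<bar> \<le> e)"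
  shows "convergent X"
proof (rule Cauchy_convergent, rule metric_CauchyI)
  fix e :: real assume "0 < e"
  then obtain Y where Y: "convergent Y" "\<And>n. \<bar>X n - Y n\<bar> \<le> e / 4" using assms[of "e / 4"] by auto
  have "0 < e / 4" using \<open>0 < e\<close> by simp
  from metric_CauchyD[OF convergent_Cauchy[OF Y(1)] this] obtain N
    where N: "\<forall>m\<ge>N. \<forall>n\<ge>N. dist (Y m) (Y n) < e / 4" ..
  have "dist (X m) (X n) < e" if "N \<le> m" "N \<le> n" for m n
  proof -
    have "\<bar>Y m - Y n\<bar> < e / 4" using N that by (simp add: dist_real_def)
    with Y(2)[of m] Y(2)[of n] have "\<bar>X m - X n\<bar> < e" by linarith
    then show ?thesis by (simp add: dist_real_def)
  qed
  then show "\<exists>N. \<forall>m\<ge>N. \<forall>n\<ge>N. dist (X m) (X n) < e" by blast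
qed

lemma birkhoff_average_add:
  "birkhoff_average T (\<lambda>x. f x + g x) x = (\<lambda>n. birkhoff_average T f x n + birkhoff_average T g x n)"
  by (simp add: fun_eq_iff birkhoff_average_def sum.distrib add_divide_distrib)

lemma birkhoff_average_scale:
  "birkhoff_average T (\<lambda>x. c * f x) x = (\<lambda>n. c * birkhoff_average T f x n)"
  by (simp add: fun_eq_iff birkhoff_average_def sum_distrib_left)

lemma birkhoff_average_sum:
  "birkhoff_average T (\<lambda>x. \<Sum>k\<in>I. c k * g k x) x = (\<lambda>n. \<Sum>k\<in>I. c k * birkhoff_average T (g k) x n)"
  by (induction I rule: infinite_finite_induct)
    (simp_all add: birkhoff_average_add birkhoff_average_scale, simp_all add: fun_eq_iff birkhoff_average_def)

lemma birkhoff_average_diff: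
  "birkhoff_average T f x n - birkhoff_average T g x n = birkhoff_average T (\<lambda>x. f x - g x) x n"
  by (simp add: birkhoff_average_def sum_subtractf diff_divide_distrib)

lemma birkhoff_average_comp: "birkhoff_average T (\<lambda>x. f (T x)) x = birkhoff_average T f (T x)"
  by (simp add: fun_eq_iff birkhoff_average_def funpow_swap1)

lemma birkhoff_average_const: "0 < n \<Longrightarrow> birkhoff_average T (\<lambda>_. c) x n = c"
  by (simp add: birkhoff_average_def)

locale compact_system =
  fixes T :: "'a::metric_space \<Rightarrow> 'a"
  assumes compact: "compact (UNIV :: 'a set)" and T_cont: "continuous_on UNIV T"
begin

lemma T_borel [measurable]: "T \<in> measurable borel borel"
  using T_cont by (rule borel_measurable_continuous_onI)

lemma invariant_measure_preserving:
  assumes "\<mu> \<in> invariant_measures T"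
  shows "measure_preserving \<mu> T"
proof -
  have \<mu>: "\<mu> \<in> borel_probs" "\<And>A. A \<in> sets borel \<Longrightarrow> emeasure \<mu> (T -` A) = emeasure \<mu> A"
    using assms by (auto simp: invariant_measures_def)
  interpret prob_space \<mu> using \<mu>(1) by (rule borel_probsD)
  have [measurable_cong]: "sets \<mu> = sets borel" using \<mu>(1) by (rule borel_probsD)
  have T: "T \<in> measurable \<mu> \<mu>" by measurable
  moreover have "distr \<mu> \<mu> T = \<mu>"
    using \<mu> T by (intro measure_eqI) (auto simp: emeasure_distr borel_probsD)
  ultimately show ?thesis by unfold_locales
qed

lemma invariant_measuresI:
  assumes \<mu>: "\<mu> \<in> borel_probs"
    and eq: "\<And>f :: 'a \<Rightarrow> real. continuous_on UNIV f \<Longrightarrow> (\<integral>x. f (T x) \<partial>\<mu>) = (\<integral>x. f x \<partial>\<mu>)"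
  shows "\<mu> \<in> invariant_measures T"
proof -
  interpret prob_space \<mu> using \<mu> by (rule borel_probsD)
  have [measurable_cong]: "sets \<mu> = sets borel" using \<mu> by (rule borel_probsD)
  have T: "T \<in> measurable \<mu> borel" by measurable
  have "distr \<mu> borel T \<in> borel_probs"
    using T by (auto simp: space_prob_algebra intro: prob_space_distr)
  then have "distr \<mu> borel T = \<mu>"
    using \<mu> by (rule borel_probs_eqI) (simp add: integral_distr[OF T] borel_measurable_continuous_onI eq)
  then have "emeasure \<mu> (T -` A) = emeasure \<mu> A" if "A \<in> sets borel" for A
    using that emeasure_distr[OF T, of A] \<mu> by (simp add: borel_probsD)
  then show ?thesis using \<mu> by (simp add: invariant_measures_def)
qed

section \<open>Regular points and their limit measures\<close>

definition regular_points :: "'a set" where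
  "regular_points = {x. \<forall>f :: 'a \<Rightarrow> real. continuous_on UNIV f \<longrightarrow> convergent (birkhoff_average T f x)}"

text \<open>One family is fixed by choice, so that the null sets and the Borel descriptions below
  all refer to the same countably many functions.\<close>

definition test_fun :: "nat \<Rightarrow> 'a \<Rightarrow> real" where
  "test_fun = (SOME g. (\<forall>k. continuous_on UNIV (g k)) \<and> (\<forall>f e. continuous_on UNIV f \<longrightarrow> 0 < e \<longrightarrow>
      (\<exists>I c. finite I \<and> (\<forall>x. \<bar>f x - (\<Sum>k\<in>I. c k * g k x)\<bar> \<le> e))))"

lemma test_fun_cont: "continuous_on UNIV (test_fun k)"
  and test_fun_dense: "continuous_on UNIV f \<Longrightarrow> 0 < e \<Longrightarrow>
      \<exists>I c. finite I \<and> (\<forall>x. \<bar>f x - (\<Sum>k\<in>I. c k * test_fun k x)\<bar> \<le> e)"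
proof -
  let ?P = "\<lambda>g :: nat \<Rightarrow> 'a \<Rightarrow> real. (\<forall>k. continuous_on UNIV (g k)) \<and>
    (\<forall>f e. continuous_on UNIV f \<longrightarrow> 0 < e \<longrightarrow>
      (\<exists>I c. finite I \<and> (\<forall>x. \<bar>f x - (\<Sum>k\<in>I. c k * g k x)\<bar> \<le> e)))"
  obtain g :: "nat \<Rightarrow> 'a \<Rightarrow> real" where "\<And>k. continuous_on UNIV (g k)"
    "\<And>f e. continuous_on UNIV f \<Longrightarrow> 0 < e \<Longrightarrow>
      \<exists>I c. finite I \<and> (\<forall>x. \<bar>f x - (\<Sum>k\<in>I. c k * g k x)\<bar> \<le> e)"
    using countable_dense_span[OF compact] by blast
  then have "\<exists>g. ?P g" by (intro exI[of _ g]) blast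
  then have "?P test_fun" unfolding test_fun_def by (rule someI_ex)
  then show "continuous_on UNIV (test_fun k)"
    "continuous_on UNIV f \<Longrightarrow> 0 < e \<Longrightarrow>
      \<exists>I c. finite I \<and> (\<forall>x. \<bar>f x - (\<Sum>k\<in>I. c k * test_fun k x)\<bar> \<le> e)" by auto
qed

lemma test_fun_measurable [measurable]: "test_fun k \<in> borel_measurable borel"
  using test_fun_cont by (rule borel_measurable_continuous_onI)

lemma test_fun_bounded: obtains B where "\<And>x. \<bar>test_fun k x\<bar> \<le> B"
  using compact_space_continuous_bounded[OF compact test_fun_cont] by blast

text \<open>Combinations of test functions approximate each continuous function uniformly, hence
  also its integral. Equality of measures thus becomes a countable conjunction, which is compatible
  with almost everywhere statements.\<close>

lemma borel_probs_eq_testI: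
  assumes \<mu>: "\<mu> \<in> borel_probs" and \<nu>: "\<nu> \<in> borel_probs"
    and eq: "\<And>k. (\<integral>x. test_fun k x \<partial>\<mu>) = (\<integral>x. test_fun k x \<partial>\<nu>)"
  shows "\<mu> = \<nu>"
proof (rule borel_probs_eqI[OF \<mu> \<nu>])
  fix f :: "'a \<Rightarrow> real" assume f: "continuous_on UNIV f"
  have "\<bar>(\<integral>x. f x \<partial>\<mu>) - (\<integral>x. f x \<partial>\<nu>)\<bar> \<le> e" if "0 < e" for e
  proof -
    obtain I c where "finite I" and a: "\<And>x. \<bar>f x - (\<Sum>k\<in>I. c k * test_fun k x)\<bar> \<le> e / 2"
      using test_fun_dense[OF f, of "e / 2"] \<open>0 < e\<close> by auto
    have *: "\<bar>(\<integral>x. f x \<partial>\<kappa>) - (\<Sum>k\<in>I. c k * (\<integral>x. test_fun k x \<partial>\<kappa>))\<bar> \<le> e / 2"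
      if \<kappa>: "\<kappa> \<in> borel_probs" for \<kappa>
    proof -
      have "integrable \<kappa> (\<lambda>x. c k * test_fun k x)" for k
        using continuous_integrable[OF compact test_fun_cont \<kappa>] by simp
      then show ?thesis
        using integral_cong_dist[OF \<kappa> continuous_integrable[OF compact f \<kappa>], of "\<lambda>x. \<Sum>k\<in>I. c k * test_fun k x" "e / 2", OF _ a]
        by (simp add: Bochner_Integration.integral_sum)
    qed
    show ?thesis using *[OF \<mu>] *[OF \<nu>] unfolding eq by linarith
  qed
  then have "\<bar>(\<integral>x. f x \<partial>\<mu>) - (\<integral>x. f x \<partial>\<nu>)\<bar> \<le> 0" by (rule field_le_epsilon[of _ 0, simplified])
  then show "(\<integral>x. f x \<partial>\<mu>) = (\<integral>x. f x \<partial>\<nu>)" by simp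
qed

text \<open>A uniform approximation of \<open>f\<close> changes all averages by at most the same
  error, so \<open>convergent_approx\<close> applies. The countable form yields both measurability
  and full measure of the regular points.\<close>

lemma regular_points_eq: "regular_points = {x. \<forall>k. convergent (birkhoff_average T (test_fun k) x)}"
proof (intro set_eqI iffI)
  fix x assume "x \<in> {x. \<forall>k. convergent (birkhoff_average T (test_fun k) x)}"
  then have conv: "convergent (birkhoff_average T (test_fun k) x)" for k by blast
  have "convergent (birkhoff_average T f x)" if f: "continuous_on UNIV f" for f
  proof (rule convergent_approx)
    fix e :: real assume "0 < e"
    then obtain I c where "finite I" and a: "\<And>x. \<bar>f x - (\<Sum>k\<in>I. c k * test_fun k x)\<bar> \<le> e"
      using test_fun_dense[OF f, of e] by blast
    have "convergent (birkhoff_average T (\<lambda>x. \<Sum>k\<in>I. c k * test_fun k x) x)"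
      unfolding birkhoff_average_sum
      by (intro convergent_sum convergent_mult convergent_const conv)
    moreover have "\<bar>birkhoff_average T f x n - birkhoff_average T (\<lambda>x. \<Sum>k\<in>I. c k * test_fun k x) x n\<bar> \<le> e" for n
      unfolding birkhoff_average_diff by (intro birkhoff_average_bound a)
    ultimately show "\<exists>Y. convergent Y \<and> (\<forall>n. \<bar>birkhoff_average T f x n - Y n\<bar> \<le> e)" by blast
  qed
  then show "x \<in> regular_points" by (simp add: regular_points_def)
qed (simp add: regular_points_def test_fun_cont)

lemma birkhoff_average_borel [measurable]:
  assumes [measurable]: "f \<in> borel_measurable borel"
  shows "(\<lambda>x. birkhoff_average T f x n) \<in> borel_measurable borel"
proof -
  have [measurable]: "(T ^^ i) \<in> measurable borel borel" for i
    by (induction i) (auto intro: measurable_comp[OF _ T_borel] simp: id_def)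
  show ?thesis unfolding birkhoff_average_def by measurable
qed

lemma regular_points_borel [measurable]: "regular_points \<in> sets borel"
proof -
  have "{x \<in> space borel. Cauchy (\<lambda>n. birkhoff_average T (test_fun k) x n)} \<in> sets borel" for k
    by (rule sets_Collect_Cauchy) measurable
  then have "(\<Inter>k. {x. Cauchy (birkhoff_average T (test_fun k) x)}) \<in> sets borel"
    by (intro sets.countable_INT'') auto
  also have "(\<Inter>k. {x. Cauchy (birkhoff_average T (test_fun k) x)}) = regular_points"
    by (auto simp: regular_points_eq Cauchy_convergent_iff)
  finally show ?thesis .
qed

lemma limitin_empirical_iff:
  "limitin weak_topology (empirical_measure T x) \<nu> sequentially \<longleftrightarrow> \<nu> \<in> borel_probs \<and>
    (\<forall>f :: 'a \<Rightarrow> real. continuous_on UNIV f \<longrightarrow> birkhoff_average T f x \<longlonglongrightarrow> (\<integral>y. f y \<partial>\<nu>))"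
proof -
  have "\<forall>\<^sub>F n in sequentially. empirical_measure T x n \<in> borel_probs"
    by (rule eventually_sequentiallyI[of 1]) (simp add: empirical_measure_in_borel_probs)
  moreover have "(\<lambda>n. \<integral>y. f y \<partial>empirical_measure T x n) \<longlonglongrightarrow> l \<longleftrightarrow> birkhoff_average T f x \<longlonglongrightarrow> l"
    if "continuous_on UNIV f" for f :: "'a \<Rightarrow> real" and l
    using that by (intro tendsto_cong eventually_sequentiallyI[of 1])
      (simp add: integral_empirical_measure borel_measurable_continuous_onI)
  ultimately show ?thesis by (auto simp: limitin_weak_topology_iff)
qed

lemma limit_measure_eqI:
  assumes "limitin weak_topology (empirical_measure T x) \<nu> sequentially"
  shows "limit_measure T x = \<nu>"
  unfolding limit_measure_def
proof (rule the_equality)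
  show "limitin weak_topology (empirical_measure T x) \<nu> sequentially" by (rule assms)
  fix \<nu>' assume "limitin weak_topology (empirical_measure T x) \<nu>' sequentially"
  with assms show "\<nu>' = \<nu>"
    by (intro borel_probs_eqI) (auto simp: limitin_empirical_iff intro: LIMSEQ_unique)
qed

lemma limit_measure_limitin:
  assumes x: "x \<in> regular_points"
  shows "limitin weak_topology (empirical_measure T x) (limit_measure T x) sequentially"
proof -
  define L where "L f = lim (birkhoff_average T f x)" for f
  have L: "birkhoff_average T f x \<longlonglongrightarrow> L f" if "continuous_on UNIV f" for f
    using x that by (simp add: L_def regular_points_def convergent_LIMSEQ_iff)
  \<comment> \<open>The axioms are limit laws for averages. The measure \<open>rep\<close> that the
    Riesz construction attaches to this \<open>L\<close> is the weak limit sought.\<close>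
  interpret positive_functional L
  proof
    fix f g :: "'a \<Rightarrow> real" and c :: real
    assume f: "continuous_on UNIV f"
    show "L (\<lambda>x. c * f x) = c * L f"
      using f L[of "\<lambda>x. c * f x"] tendsto_mult_left[OF L[OF f], of c]
      by (simp add: birkhoff_average_scale continuous_intros LIMSEQ_unique)
    { assume g: "continuous_on UNIV g"
      show "L (\<lambda>x. f x + g x) = L f + L g"
        using f g L[of "\<lambda>x. f x + g x"] tendsto_add[OF L[OF f] L[OF g]]
        by (simp add: birkhoff_average_add continuous_intros LIMSEQ_unique) }
    { assume "\<And>x. 0 \<le> f x"
      then show "0 \<le> L f"
        using L[OF f] by (intro LIMSEQ_le_const[OF L[OF f]])
          (auto simp: birkhoff_average_def intro!: divide_nonneg_nonneg sum_nonneg) }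
  next
    have "birkhoff_average T (\<lambda>_. 1) x \<longlonglongrightarrow> 1"
      by (intro tendsto_eventually eventually_sequentiallyI[of 1]) (simp add: birkhoff_average_const)
    then show "L (\<lambda>_. 1) = 1" using L[of "\<lambda>_. 1"] by (simp add: LIMSEQ_unique)
  qed (rule compact)
  have "limitin weak_topology (empirical_measure T x) rep sequentially"
    by (simp add: limitin_empirical_iff rep_in_borel_probs integral_rep L)
  then show ?thesis using limit_measure_eqI by metis
qed

lemma limit_measure_borel_probs: "x \<in> regular_points \<Longrightarrow> limit_measure T x \<in> borel_probs"
  and birkhoff_average_tendsto: "x \<in> regular_points \<Longrightarrow> continuous_on UNIV f \<Longrightarrow>
    birkhoff_average T f x \<longlonglongrightarrow> (\<integral>y. f y \<partial>limit_measure T x)"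
  using limit_measure_limitin limitin_empirical_iff by blast+

lemma birkhoff_average_shift_cont:
  fixes f :: "'a \<Rightarrow> real"
  assumes "continuous_on UNIV f"
  shows "(\<lambda>n. birkhoff_average T f (T x) n - birkhoff_average T f x n) \<longlonglongrightarrow> 0"
  using compact_space_continuous_bounded[OF compact assms] birkhoff_average_shift_tendsto by metis

lemma birkhoff_average_T_tendsto_iff:
  fixes f :: "'a \<Rightarrow> real"
  assumes "continuous_on UNIV f"
  shows "birkhoff_average T f (T x) \<longlonglongrightarrow> l \<longleftrightarrow> birkhoff_average T f x \<longlonglongrightarrow> l"
  using tendsto_add[OF birkhoff_average_shift_cont[OF assms, of x], of "birkhoff_average T f x" l]
    tendsto_diff[OF _ birkhoff_average_shift_cont[OF assms, of x], of "birkhoff_average T f (T x)" l]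
  by auto

text \<open>Averages of a continuous function at \<open>x\<close> and at \<open>T x\<close> have the
  same limits. The two \<open>THE\<close> terms thus have the same defining predicate, at regular
  and irregular points alike.\<close>

lemma limit_measure_T: "limit_measure T (T x) = limit_measure T x"
  unfolding limit_measure_def limitin_empirical_iff
  by (simp add: birkhoff_average_T_tendsto_iff cong: imp_cong)

lemma T_regular_points_iff: "T x \<in> regular_points \<longleftrightarrow> x \<in> regular_points"
  by (simp add: regular_points_def convergent_def birkhoff_average_T_tendsto_iff cong: imp_cong)

text \<open>The averages of \<open>f \<circ> T\<close> at \<open>x\<close> are those of
  \<open>f\<close> at \<open>T x\<close>, which have the same limit as those at
  \<open>x\<close>.\<close>

lemma limit_measure_invariant:
  assumes x: "x \<in> regular_points"
  shows "limit_measure T x \<in> invariant_measures T"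
proof (rule invariant_measuresI)
  show "limit_measure T x \<in> borel_probs" using x by (rule limit_measure_borel_probs)
  fix f :: "'a \<Rightarrow> real" assume f: "continuous_on UNIV f"
  have "continuous_on UNIV (\<lambda>x. f (T x))"
    using continuous_on_compose2[OF f T_cont] by simp
  from birkhoff_average_tendsto[OF x this]
  have "birkhoff_average T f x \<longlonglongrightarrow> (\<integral>y. f (T y) \<partial>limit_measure T x)"
    by (simp add: birkhoff_average_comp birkhoff_average_T_tendsto_iff[OF f])
  then show "(\<integral>y. f (T y) \<partial>limit_measure T x) = (\<integral>y. f y \<partial>limit_measure T x)"
    using birkhoff_average_tendsto[OF x f] by (rule LIMSEQ_unique)
qed

text \<open>The constant value outside \<open>regular_points\<close> makes \<open>limit_kernel\<close> a total and invariant kernel.\<close>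

definition limit_kernel :: "'a \<Rightarrow> 'a measure" where
  "limit_kernel x = (if x \<in> regular_points then limit_measure T x else return borel undefined)"

lemma limit_kernel_borel_probs: "limit_kernel x \<in> borel_probs"
proof (cases "x \<in> regular_points")
  case True
  then show ?thesis by (simp add: limit_kernel_def limit_measure_borel_probs)
next
  case False
  then show ?thesis by (simp add: limit_kernel_def space_prob_algebra prob_space_return)
qed

lemma limit_kernel_T: "limit_kernel (T x) = limit_kernel x"
  by (simp add: limit_kernel_def limit_measure_T T_regular_points_iff)

lemma limit_kernel_measurable [measurable]: "limit_kernel \<in> measurable borel (subprob_algebra borel)"
proof (rule kernel_measurable)
  fix f :: "'a \<Rightarrow> real" assume f: "continuous_on UNIV f"
  have [measurable]: "f \<in> borel_measurable borel" using f by (rule borel_measurable_continuous_onI)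
  \<comment> \<open>Off the regular points \<open>u\<close> takes the default value of the kernel,
    so that \<open>u n x\<close> converges at every \<open>x\<close>.\<close>
  define u where "u n x = (if x \<in> regular_points then birkhoff_average T f x n
      else (\<integral>y. f y \<partial>return borel undefined))" for n x
  show "(\<lambda>x. \<integral>y. f y \<partial>limit_kernel x) \<in> borel_measurable borel"
  proof (rule borel_measurable_LIMSEQ_real)
    show "u n \<in> borel_measurable borel" for n unfolding u_def by measurable
    show "(\<lambda>n. u n x) \<longlonglongrightarrow> (\<integral>y. f y \<partial>limit_kernel x)" for x
      using birkhoff_average_tendsto[OF _ f] by (simp add: u_def limit_kernel_def)
  qed
qed (rule limit_kernel_borel_probs)

section \<open>Time means under an invariant measure\<close>

text \<open>At a regular point this is the limit of the averages if \<open>f\<close> is continuous.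
  For a Borel \<open>f\<close> it is defined through the kernel and need not be such a
  limit.\<close>

definition time_mean :: "('a \<Rightarrow> real) \<Rightarrow> 'a \<Rightarrow> real" where
  "time_mean f x = (\<integral>y. f y \<partial>limit_kernel x)"

lemma time_mean_measurable [measurable]:
  assumes [measurable]: "f \<in> borel_measurable borel"
  shows "time_mean f \<in> borel_measurable borel"
  unfolding time_mean_def by measurable

lemma time_mean_bound:
  assumes "f \<in> borel_measurable borel" "\<And>x. \<bar>f x\<bar> \<le> B"
  shows "\<bar>time_mean f x\<bar> \<le> B"
proof -
  have "integrable (limit_kernel x) f" using limit_kernel_borel_probs assms by (rule borel_probs_integrable)
  from integral_cong_dist[OF limit_kernel_borel_probs this, of "\<lambda>_. 0" B] show ?thesis
    using assms by (simp add: time_mean_def)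
qed

lemma time_mean_T: "time_mean f (T x) = time_mean f x"
  by (simp add: time_mean_def limit_kernel_T)

lemma AE_regular:
  assumes \<mu>: "\<mu> \<in> invariant_measures T"
  shows "AE x in \<mu>. x \<in> regular_points"
proof -
  interpret measure_preserving \<mu> T using \<mu> by (rule invariant_measure_preserving)
  have \<mu>': "\<mu> \<in> borel_probs" using \<mu> invariant_measures_subset by blast
  have "AE x in \<mu>. convergent (birkhoff_average T (test_fun k) x)" for k
  proof -
    obtain B where "\<And>x. \<bar>test_fun k x\<bar> \<le> B" using test_fun_bounded by blast
    then show ?thesis by (intro birkhoff_convergent) (simp_all add: borel_probs_measurable[OF \<mu>'])
  qed
  then show ?thesis by (simp add: regular_points_eq AE_all_countable)
qed

lemma integral_time_mean:
  assumes \<mu>: "\<mu> \<in> invariant_measures T"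
    and f: "f \<in> borel_measurable borel" "\<And>x. \<bar>f x\<bar> \<le> B"
  shows "(\<integral>x. time_mean f x \<partial>\<mu>) = (\<integral>x. f x \<partial>\<mu>)"
proof -
  interpret measure_preserving \<mu> T using \<mu> by (rule invariant_measure_preserving)
  have \<mu>': "\<mu> \<in> borel_probs" using \<mu> invariant_measures_subset by blast
  have [measurable_cong]: "sets \<mu> = sets borel" using \<mu>' by (rule borel_probsD)
  have meas: "limit_kernel \<in> measurable \<mu> (subprob_algebra borel)" by measurable
  have "(\<integral>x. g x \<partial>\<mu>) = (\<integral>x. (\<integral>y. g y \<partial>limit_kernel x) \<partial>\<mu>)" if g: "continuous_on UNIV g" for g :: "'a \<Rightarrow> real"
  proof -
    have [measurable]: "g \<in> borel_measurable borel" using g by (rule borel_measurable_continuous_onI)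
    obtain B where B: "\<And>x. \<bar>g x\<bar> \<le> B" using compact_space_continuous_bounded[OF compact g] by blast
    have "(\<lambda>n. \<integral>x. birkhoff_average T g x n \<partial>\<mu>) \<longlonglongrightarrow> (\<integral>x. (\<integral>y. g y \<partial>limit_kernel x) \<partial>\<mu>)"
    proof (rule integral_dominated_convergence[where w = "\<lambda>_. B"])
      show "AE x in \<mu>. birkhoff_average T g x \<longlonglongrightarrow> (\<integral>y. g y \<partial>limit_kernel x)"
        using AE_regular[OF \<mu>] by (rule AE_mp) (auto simp: limit_kernel_def birkhoff_average_tendsto[OF _ g])
      show "AE x in \<mu>. norm (birkhoff_average T g x n) \<le> B" for n
        using birkhoff_average_bound[of g, OF B] by simp
    qed auto
    moreover have "(\<lambda>n. \<integral>x. birkhoff_average T g x n \<partial>\<mu>) \<longlonglongrightarrow> (\<integral>x. g x \<partial>\<mu>)"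
      using B by (intro tendsto_eventually eventually_sequentiallyI[of 1] integral_birkhoff_average) auto
    ultimately show ?thesis by (metis LIMSEQ_unique)
  qed
  \<comment> \<open>The identity for continuous functions exhibits \<open>\<mu>\<close> as the
    mixture of its limit measures, which extends it to bounded Borel \<open>f\<close>.\<close>
  from integral_kernel[OF compact prob_space_axioms \<mu>' limit_kernel_borel_probs meas this f]
  show ?thesis by (simp add: time_mean_def)
qed

section \<open>A criterion for ergodicity\<close>

text \<open>The set where \<open>h\<close> is below its mean \<open>c\<close> is strictly invariant,
  so it has measure 0 or 1, and measure 1 would force the mean below \<open>c\<close>. Hence
  \<open>h - c\<close> is almost everywhere nonnegative with integral 0.\<close>

lemma ergodic_invariant_function_const:
  fixes h :: "'a \<Rightarrow> real"
  assumes \<nu>: "\<nu> \<in> ergodic_measures T" and h[measurable]: "h \<in> borel_measurable borel"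
    and B: "\<And>x. \<bar>h x\<bar> \<le> B" and inv: "\<And>x. h (T x) = h x"
  shows "AE x in \<nu>. h x = (\<integral>x. h x \<partial>\<nu>)"
proof -
  have \<nu>': "\<nu> \<in> borel_probs" using \<nu> ergodic_measures_subset invariant_measures_subset by blast
  interpret prob_space \<nu> using \<nu>' by (rule borel_probsD)
  have sets[measurable_cong]: "sets \<nu> = sets borel" using \<nu>' by (rule borel_probsD)
  have space: "space \<nu> = UNIV" using \<nu>' by (rule borel_probsD)
  have int: "integrable \<nu> h" using \<nu>' h B by (rule borel_probs_integrable)
  define c where "c = (\<integral>x. h x \<partial>\<nu>)"
  have "AE x in \<nu>. c \<le> h x"
  proof -
    let ?A = "{x. h x < c}"
    have A: "?A \<in> sets borel" by measurable
    moreover have "T -` ?A = ?A" by (auto simp: inv)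
    ultimately have "emeasure \<nu> ?A = 0 \<or> emeasure \<nu> ?A = 1"
      using \<nu> by (auto simp: ergodic_measures_def)
    moreover have "emeasure \<nu> ?A \<noteq> 1"
    proof
      assume "emeasure \<nu> ?A = 1"
      then have lt: "AE x in \<nu>. h x < c"
        using AE_in_set_eq_1[of ?A] A by (simp add: sets emeasure_eq_measure)
      have "(\<integral>x. h x \<partial>\<nu>) < (\<integral>x. c \<partial>\<nu>)"
      proof (rule integral_less_AE_space[OF int])
        show "emeasure \<nu> (space \<nu>) \<noteq> 0" by (simp add: emeasure_space_1)
        show "AE x in \<nu>. h x < c" by (rule lt)
      qed simp
      then show False by (simp add: c_def prob_space)
    qed
    ultimately have "emeasure \<nu> ?A = 0" by blast
    then show ?thesis using A by (subst AE_iff_measurable[of ?A]) (auto simp: sets space not_le)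
  qed
  moreover have "(\<integral>x. h x - c \<partial>\<nu>) = 0" using int by (simp add: c_def prob_space)
  ultimately have "AE x in \<nu>. h x - c = 0"
    using int by (subst integral_nonneg_eq_0_iff_AE[symmetric]) auto
  then show ?thesis by (simp add: c_def)
qed

text \<open>Conditioning on an invariant set \<open>A\<close> of positive measure gives an invariant
  measure \<open>?U\<close>, absolutely continuous with respect to \<open>\<nu>\<close>. Under
  \<open>?U\<close> the time mean of the indicator of \<open>A\<close> is almost everywhere the
  measure of \<open>A\<close> under \<open>\<nu>\<close>, yet it integrates to
  \<open>measure ?U A\<close>, which is 1.\<close>

lemma ergodic_if_limit_kernel_const:
  assumes \<nu>: "\<nu> \<in> invariant_measures T" and const: "AE y in \<nu>. limit_kernel y = \<nu>"
  shows "\<nu> \<in> ergodic_measures T"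
proof -
  have \<nu>': "\<nu> \<in> borel_probs" using \<nu> invariant_measures_subset by blast
  interpret prob_space \<nu> using \<nu>' by (rule borel_probsD)
  have sets[measurable_cong]: "sets \<nu> = sets borel" using \<nu>' by (rule borel_probsD)
  have space: "space \<nu> = UNIV" using \<nu>' by (rule borel_probsD)
  have "emeasure \<nu> A = 1"
    if A[measurable]: "A \<in> sets borel" and inv: "T -` A = A" and pos: "emeasure \<nu> A \<noteq> 0" for A
  proof -
    let ?U = "uniform_measure \<nu> A"
    have "prob_space ?U" using pos by (intro prob_space_uniform_measure) auto
    then have U': "?U \<in> borel_probs" by (simp add: space_prob_algebra sets)
    then interpret U: prob_space ?U by (simp add: borel_probsD)
    have "emeasure ?U (T -` C) = emeasure ?U C" if C[measurable]: "C \<in> sets borel" for C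
    proof -
      have TC: "T -` C \<in> sets borel" using measurable_sets[OF T_borel C] by simp
      have "A \<inter> C \<in> sets borel" using A C by (rule sets.Int)
      then have "emeasure \<nu> (T -` (A \<inter> C)) = emeasure \<nu> (A \<inter> C)"
        using \<nu> unfolding invariant_measures_def by blast
      moreover have "T -` (A \<inter> C) = A \<inter> T -` C" using inv by blast
      ultimately have "emeasure \<nu> (A \<inter> T -` C) = emeasure \<nu> (A \<inter> C)" by simp
      then show ?thesis using TC C A by (simp add: sets)
    qed
    then have U: "?U \<in> invariant_measures T" using U' by (simp add: invariant_measures_def)
    have ind: "(indicator A :: 'a \<Rightarrow> real) \<in> borel_measurable borel" by measurable
    have "AE y in ?U. limit_kernel y = \<nu>"
      using const by (intro AE_uniform_measureI) (auto simp: sets)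
    then have "AE y in ?U. time_mean (indicator A) y = (\<integral>x. indicator A x \<partial>\<nu>)"
      by (rule eventually_mono) (simp add: time_mean_def)
    then have "(\<integral>y. time_mean (indicator A) y \<partial>?U) = (\<integral>y. (\<integral>x. indicator A x \<partial>\<nu>) \<partial>?U)"
      using time_mean_measurable[OF ind]
      by (intro integral_cong_AE) (simp_all add: borel_probs_measurable[OF U'])
    also have "\<dots> = measure \<nu> A" using U.prob_space by (simp add: sets space)
    finally have "measure \<nu> A = (\<integral>y. indicator A y \<partial>?U)"
      using integral_time_mean[OF U ind, of 1] by simp
    also have "\<dots> = measure ?U A" by (simp add: sets space)
    also have "\<dots> = 1" using pos by (simp add: sets measure_uniform_measure emeasure_eq_measure)
    finally show ?thesis by (simp add: emeasure_eq_measure)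
  qed
  then show ?thesis using \<nu> by (auto simp: ergodic_measures_def)
qed

lemma integral_square_diff:
  fixes h :: "'a \<Rightarrow> real"
  assumes \<nu>: "\<nu> \<in> borel_probs" and h: "h \<in> borel_measurable borel" "\<And>x. \<bar>h x\<bar> \<le> B"
  shows "integrable \<nu> (\<lambda>x. (h x - c)\<^sup>2)"
    and "(\<integral>x. (h x - c)\<^sup>2 \<partial>\<nu>) = (\<integral>x. (h x)\<^sup>2 \<partial>\<nu>) - 2 * c * (\<integral>x. h x \<partial>\<nu>) + c\<^sup>2"
proof -
  interpret prob_space \<nu> using \<nu> by (rule borel_probsD)
  have int: "integrable \<nu> h" using \<nu> h by (rule borel_probs_integrable)
  have "\<bar>(h x)\<^sup>2\<bar> \<le> B\<^sup>2" for x using h(2)[of x] by (simp add: abs_le_square_iff[symmetric])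
  then have int2: "integrable \<nu> (\<lambda>x. (h x)\<^sup>2)"
    using \<nu> h(1) by (intro borel_probs_integrable[of _ _ "B\<^sup>2"]) auto
  have eq: "(h x - c)\<^sup>2 = (h x)\<^sup>2 - 2 * c * h x + c\<^sup>2" for x
    by (simp add: power2_diff algebra_simps)
  show "integrable \<nu> (\<lambda>x. (h x - c)\<^sup>2)" unfolding eq using int int2 by simp
  show "(\<integral>x. (h x - c)\<^sup>2 \<partial>\<nu>) = (\<integral>x. (h x)\<^sup>2 \<partial>\<nu>) - 2 * c * (\<integral>x. h x \<partial>\<nu>) + c\<^sup>2"
    unfolding eq using int int2 by (simp add: prob_space)
qed

text \<open>The time mean of \<open>test_fun k\<close> has the same \<open>\<nu>\<close>-mean as
  \<open>test_fun k\<close>, so the condition says that its variance vanishes. The right side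
  consists of countably many equations between integrals, which are measurable in \<open>x\<close>
  when \<open>\<nu>\<close> is the limit measure of \<open>x\<close>.\<close>

lemma ergodic_iff:
  assumes \<nu>: "\<nu> \<in> invariant_measures T"
  shows "\<nu> \<in> ergodic_measures T \<longleftrightarrow>
    (\<forall>k. (\<integral>y. (time_mean (test_fun k) y)\<^sup>2 \<partial>\<nu>) = (\<integral>y. test_fun k y \<partial>\<nu>)\<^sup>2)"
proof
  have \<nu>': "\<nu> \<in> borel_probs" using \<nu> invariant_measures_subset by blast
  interpret prob_space \<nu> using \<nu>' by (rule borel_probsD)
  have sets[measurable_cong]: "sets \<nu> = sets borel" using \<nu>' by (rule borel_probsD)
  have tm: "\<exists>B. (\<forall>x. \<bar>time_mean (test_fun k) x\<bar> \<le> B) \<and>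
      (\<integral>y. time_mean (test_fun k) y \<partial>\<nu>) = (\<integral>y. test_fun k y \<partial>\<nu>)" for k
  proof -
    obtain B where "\<And>x. \<bar>test_fun k x\<bar> \<le> B" using test_fun_bounded by blast
    then show ?thesis
      using time_mean_bound[OF test_fun_measurable, of k B] integral_time_mean[OF \<nu> test_fun_measurable, of k B]
      by blast
  qed
  show "\<forall>k. (\<integral>y. (time_mean (test_fun k) y)\<^sup>2 \<partial>\<nu>) = (\<integral>y. test_fun k y \<partial>\<nu>)\<^sup>2"
    if erg: "\<nu> \<in> ergodic_measures T"
  proof
    fix k
    obtain B where B: "\<And>x. \<bar>time_mean (test_fun k) x\<bar> \<le> B"
      and eq: "(\<integral>y. time_mean (test_fun k) y \<partial>\<nu>) = (\<integral>y. test_fun k y \<partial>\<nu>)" using tm by blast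
    have "AE y in \<nu>. time_mean (test_fun k) y = (\<integral>y. test_fun k y \<partial>\<nu>)"
      using ergodic_invariant_function_const[OF erg time_mean_measurable[OF test_fun_measurable] B time_mean_T]
      unfolding eq .
    then have "(\<integral>y. (time_mean (test_fun k) y)\<^sup>2 \<partial>\<nu>) = (\<integral>y. (\<integral>y. test_fun k y \<partial>\<nu>)\<^sup>2 \<partial>\<nu>)"
      by (intro integral_cong_AE) auto
    then show "(\<integral>y. (time_mean (test_fun k) y)\<^sup>2 \<partial>\<nu>) = (\<integral>y. test_fun k y \<partial>\<nu>)\<^sup>2"
      by (simp add: prob_space)
  qed
  assume R: "\<forall>k. (\<integral>y. (time_mean (test_fun k) y)\<^sup>2 \<partial>\<nu>) = (\<integral>y. test_fun k y \<partial>\<nu>)\<^sup>2"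
  have "AE y in \<nu>. time_mean (test_fun k) y = (\<integral>y. test_fun k y \<partial>\<nu>)" for k
  proof -
    obtain B where B: "\<And>x. \<bar>time_mean (test_fun k) x\<bar> \<le> B"
      and eq: "(\<integral>y. time_mean (test_fun k) y \<partial>\<nu>) = (\<integral>y. test_fun k y \<partial>\<nu>)" using tm by blast
    let ?c = "\<integral>y. test_fun k y \<partial>\<nu>"
    have "(\<integral>y. (time_mean (test_fun k) y - ?c)\<^sup>2 \<partial>\<nu>) = 0"
      using integral_square_diff(2)[OF \<nu>' time_mean_measurable[OF test_fun_measurable] B, of ?c] R eq
      by (simp add: power2_eq_square)
    then have "AE y in \<nu>. (time_mean (test_fun k) y - ?c)\<^sup>2 = 0"
      using integral_square_diff(1)[OF \<nu>' time_mean_measurable[OF test_fun_measurable] B, of ?c]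
      by (subst integral_nonneg_eq_0_iff_AE[symmetric]) auto
    then show ?thesis by simp
  qed
  then have "AE y in \<nu>. \<forall>k. time_mean (test_fun k) y = (\<integral>y. test_fun k y \<partial>\<nu>)"
    by (simp add: AE_all_countable)
  then have "AE y in \<nu>. limit_kernel y = \<nu>"
  proof (rule AE_mp, intro AE_I2 impI)
    fix y assume "\<forall>k. time_mean (test_fun k) y = (\<integral>y. test_fun k y \<partial>\<nu>)"
    then show "limit_kernel y = \<nu>"
      by (intro borel_probs_eq_testI limit_kernel_borel_probs \<nu>') (simp add: time_mean_def)
  qed
  then show "\<nu> \<in> ergodic_measures T" by (rule ergodic_if_limit_kernel_const[OF \<nu>])
qed

section \<open>The ergodic support: measurability and full measure\<close>

lemma ergodic_support_iff:
  "x \<in> ergodic_support T \<longleftrightarrow> x \<in> regular_points \<and> limit_measure T x \<in> ergodic_measures T"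
proof
  assume "x \<in> ergodic_support T"
  then obtain \<nu> where \<nu>: "\<nu> \<in> ergodic_measures T"
    "limitin weak_topology (empirical_measure T x) \<nu> sequentially"
    by (auto simp: ergodic_support_def)
  then have "x \<in> regular_points"
    unfolding regular_points_def limitin_empirical_iff by (auto intro: convergentI)
  then show "x \<in> regular_points \<and> limit_measure T x \<in> ergodic_measures T"
    using limit_measure_eqI[OF \<nu>(2)] \<nu>(1) by simp
qed (auto simp: ergodic_support_def intro: limit_measure_limitin)

text \<open>This is \<open>ergodic_iff\<close> for the limit measure of \<open>x\<close>, whose
  integrals are time means at \<open>x\<close>; hence the iterated time mean. The description makes
  the ergodic support visibly Borel.\<close>

lemma ergodic_support_eq:
  "ergodic_support T = {x \<in> regular_points.
    \<forall>k. time_mean (\<lambda>y. (time_mean (test_fun k) y)\<^sup>2) x = (time_mean (test_fun k) x)\<^sup>2}"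
  using ergodic_iff[OF limit_measure_invariant]
  by (auto simp: ergodic_support_iff time_mean_def limit_kernel_def)

lemma ergodic_support_borel [measurable]: "ergodic_support T \<in> sets borel"
proof -
  have "{x \<in> space borel. x \<in> regular_points \<and>
      (\<forall>k. time_mean (\<lambda>y. (time_mean (test_fun k) y)\<^sup>2) x = (time_mean (test_fun k) x)\<^sup>2)} \<in> sets borel"
    by measurable
  then show ?thesis by (simp add: ergodic_support_eq)
qed

lemma AE_ergodic_support:
  assumes \<mu>: "\<mu> \<in> invariant_measures T"
  shows "AE x in \<mu>. x \<in> ergodic_support T"
proof -
  have \<mu>': "\<mu> \<in> borel_probs" using \<mu> invariant_measures_subset by blast
  interpret prob_space \<mu> using \<mu>' by (rule borel_probsD)
  have "AE x in \<mu>. time_mean (\<lambda>y. (time_mean (test_fun k) y)\<^sup>2) x = (time_mean (test_fun k) x)\<^sup>2" for k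
  proof -
    obtain B where B: "\<And>x. \<bar>test_fun k x\<bar> \<le> B" using test_fun_bounded by blast
    define h where "h = time_mean (test_fun k)"
    \<comment> \<open>At a regular point \<open>q x\<close> is the variance of \<open>h\<close>
      under \<open>limit_kernel x\<close>, hence nonnegative.\<close>
    define q where "q x = time_mean (\<lambda>y. (h y)\<^sup>2) x - (h x)\<^sup>2" for x
    have h[measurable]: "h \<in> borel_measurable borel" unfolding h_def by measurable
    have hB: "\<bar>h x\<bar> \<le> B" for x unfolding h_def by (rule time_mean_bound[OF test_fun_measurable B])
    have h2: "(\<lambda>x. (h x)\<^sup>2) \<in> borel_measurable borel" by measurable
    have h2B: "\<bar>(h x)\<^sup>2\<bar> \<le> B\<^sup>2" for x using hB[of x] by (simp add: abs_le_square_iff[symmetric])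
    have int: "integrable \<mu> (\<lambda>x. (h x)\<^sup>2)" "integrable \<mu> (time_mean (\<lambda>y. (h y)\<^sup>2))"
      using borel_probs_integrable[OF \<mu>' h2 h2B]
        borel_probs_integrable[OF \<mu>' time_mean_measurable[OF h2] time_mean_bound[OF h2 h2B]] by auto
    have "AE x in \<mu>. 0 \<le> q x"
      using AE_regular[OF \<mu>]
    proof (rule AE_mp, intro AE_I2 impI)
      fix x assume "x \<in> regular_points"
      then have "limit_kernel x \<in> invariant_measures T" by (simp add: limit_kernel_def limit_measure_invariant)
      from integral_time_mean[OF this test_fun_measurable B]
      have "(\<integral>y. h y \<partial>limit_kernel x) = h x" by (simp add: h_def time_mean_def)
      then have "(\<integral>y. (h y - h x)\<^sup>2 \<partial>limit_kernel x) = q x"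
        using integral_square_diff(2)[OF limit_kernel_borel_probs h hB, where c = "h x"]
        by (simp add: q_def time_mean_def power2_eq_square)
      moreover have "0 \<le> (\<integral>y. (h y - h x)\<^sup>2 \<partial>limit_kernel x)" by (rule Bochner_Integration.integral_nonneg) simp
      ultimately show "0 \<le> q x" by simp
    qed
    moreover have q: "integrable \<mu> q" unfolding q_def[abs_def] using int by simp
    \<comment> \<open>The square of \<open>h\<close> and its time mean have the same integral under
      the invariant measure \<open>\<mu>\<close>.\<close>
    moreover have "(\<integral>x. q x \<partial>\<mu>) = 0"
      using int integral_time_mean[OF \<mu> h2 h2B] by (simp add: q_def)
    ultimately have "AE x in \<mu>. q x = 0" using integral_nonneg_eq_0_iff_AE by blast
    then show ?thesis by (simp add: q_def h_def)
  qed
  then have "AE x in \<mu>. \<forall>k. time_mean (\<lambda>y. (time_mean (test_fun k) y)\<^sup>2) x = (time_mean (test_fun k) x)\<^sup>2"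
    by (simp add: AE_all_countable)
  with AE_regular[OF \<mu>] show ?thesis
    by eventually_elim (simp add: ergodic_support_eq)
qed

section \<open>The decomposition of a fixed invariant measure\<close>

context
  fixes \<mu> assumes \<mu>: "\<mu> \<in> invariant_measures T"
begin

lemma invariant_borel_probs: "\<mu> \<in> borel_probs"
  using \<mu> invariant_measures_subset by blast

lemma invariant_sets [measurable_cong]: "sets \<mu> = sets borel"
  using invariant_borel_probs by (rule borel_probsD)

lemma ergodic_support_sets: "ergodic_support T \<inter> space \<mu> \<in> sets \<mu>"
  using ergodic_support_borel by (simp add: invariant_sets borel_probsD(3)[OF invariant_borel_probs])

lemma prob_space_restrict: "prob_space (restrict_space \<mu> (ergodic_support T))"
proof -
  interpret prob_space \<mu> using invariant_borel_probs by (rule borel_probsD)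
  have "emeasure \<mu> (ergodic_support T) = 1"
    using AE_ergodic_support[OF \<mu>] ergodic_support_borel
    by (subst emeasure_eq_1_AE) (auto simp: invariant_sets)
  then show ?thesis
    using ergodic_support_sets borel_probsD(3)[OF invariant_borel_probs]
    by (intro prob_spaceI) (simp add: space_restrict_space emeasure_restrict_space)
qed

text \<open>The domain is restricted to the ergodic support because only there are the values known
  to be ergodic measures. On it the integral of \<open>f\<close> against the limit measure is
  \<open>time_mean f\<close>, which is Borel.\<close>

lemma limit_measure_measurable:
  "limit_measure T \<in> measurable (restrict_space \<mu> (ergodic_support T)) (ergodic_borel T)"
proof (rule measurable_ergodic_borelI[OF compact])
  show "limit_measure T x \<in> ergodic_measures T"
    if "x \<in> space (restrict_space \<mu> (ergodic_support T))" for x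
    using that by (simp add: space_restrict_space ergodic_support_iff)
  fix f :: "'a \<Rightarrow> real" assume f: "continuous_on UNIV f"
  have [measurable]: "f \<in> borel_measurable borel" using f by (rule borel_measurable_continuous_onI)
  have "time_mean f \<in> borel_measurable (restrict_space \<mu> (ergodic_support T))"
    by (rule measurable_restrict_space1) measurable
  then show "(\<lambda>x. \<integral>y. f y \<partial>limit_measure T x) \<in> borel_measurable (restrict_space \<mu> (ergodic_support T))"
    by (rule measurable_cong[THEN iffD1, rotated])
      (auto simp: space_restrict_space ergodic_support_iff time_mean_def limit_kernel_def)
qed

text \<open>As \<open>distr\<close> is itself a \<open>measure_of\<close>, it suffices to compare
  the set functions. Measurability of the limit map then makes the pushforward a genuine image
  measure and gives change of variables.\<close>

lemma ergodic_pushforward_eq_distr: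
  "ergodic_pushforward T \<mu> =
    distr (restrict_space \<mu> (ergodic_support T)) (ergodic_borel T) (limit_measure T)"
  unfolding ergodic_pushforward_def distr_def space_ergodic_borel
proof (rule measure_of_eq)
  show "sets (ergodic_borel T) \<subseteq> Pow (ergodic_measures T)"
    using sets.space_closed[of "ergodic_borel T"] by (simp add: space_ergodic_borel)
  fix A assume "A \<in> sigma_sets (ergodic_measures T) (sets (ergodic_borel T))"
  have "{x \<in> ergodic_support T. limit_measure T x \<in> A} =
      limit_measure T -` A \<inter> space (restrict_space \<mu> (ergodic_support T))"
    by (auto simp: space_restrict_space borel_probsD(3)[OF invariant_borel_probs])
  moreover have "limit_measure T -` A \<inter> space (restrict_space \<mu> (ergodic_support T)) \<subseteq> ergodic_support T"
    by (auto simp: space_restrict_space)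
  ultimately show "emeasure \<mu> {x \<in> ergodic_support T. limit_measure T x \<in> A} =
      emeasure (restrict_space \<mu> (ergodic_support T))
        (limit_measure T -` A \<inter> space (restrict_space \<mu> (ergodic_support T)))"
    using ergodic_support_sets by (simp add: emeasure_restrict_space)
qed

text \<open>The first equality is \<open>integral_time_mean\<close> followed by discarding a null
  set, the second is change of variables. Integrability is stated alongside because a Bochner
  integral of a nonintegrable function is 0 by convention.\<close>

lemma ergodic_decomposition:
  fixes f :: "'a \<Rightarrow> real"
  assumes f: "f \<in> borel_measurable borel" and B: "\<And>x. \<bar>f x\<bar> \<le> B"
  shows "set_integrable \<mu> (ergodic_support T) (\<lambda>x. \<integral>y. f y \<partial>limit_measure T x)"
    and "integrable (ergodic_pushforward T \<mu>) (\<lambda>\<nu>. \<integral>y. f y \<partial>\<nu>)"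
    and "(\<integral>x. f x \<partial>\<mu>) = (\<integral>x\<in>ergodic_support T. (\<integral>y. f y \<partial>limit_measure T x) \<partial>\<mu>)"
    and "(\<integral>x\<in>ergodic_support T. (\<integral>y. f y \<partial>limit_measure T x) \<partial>\<mu>) =
      (\<integral>\<nu>. (\<integral>y. f y \<partial>\<nu>) \<partial>ergodic_pushforward T \<mu>)"
proof -
  let ?X = "ergodic_support T" and ?V = "limit_measure T"
  note [measurable] = f
  \<comment> \<open>On the ergodic support \<open>limit_measure\<close> and
    \<open>limit_kernel\<close> agree; off it both sides are 0.\<close>
  have eq: "indicator ?X x *\<^sub>R (\<integral>y. f y \<partial>?V x) = indicator ?X x *\<^sub>R time_mean f x" for x
    by (auto simp: indicator_def ergodic_support_iff time_mean_def limit_kernel_def)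
  have "integrable \<mu> (time_mean f)"
    using invariant_borel_probs time_mean_measurable[OF f] time_mean_bound[OF f B] by (rule borel_probs_integrable)
  then have "integrable \<mu> (\<lambda>x. indicator ?X x *\<^sub>R time_mean f x)"
    using ergodic_support_borel by (intro integrable_mult_indicator) (auto simp: invariant_sets)
  then show si: "set_integrable \<mu> ?X (\<lambda>x. \<integral>y. f y \<partial>?V x)"
    unfolding set_integrable_def eq .
  have int_\<nu>: "(\<lambda>\<nu>. \<integral>y. f y \<partial>\<nu>) \<in> borel_measurable (ergodic_borel T)"
    using measurable_compose[OF id_ergodic_borel_measurable integral_measurable_subprob_algebra[OF f]] .
  have "integrable (restrict_space \<mu> ?X) (\<lambda>x. \<integral>y. f y \<partial>?V x)"
    using si unfolding set_integrable_def by (subst integrable_restrict_space[OF ergodic_support_sets])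
  then show "integrable (ergodic_pushforward T \<mu>) (\<lambda>\<nu>. \<integral>y. f y \<partial>\<nu>)"
    unfolding ergodic_pushforward_eq_distr
    by (subst integrable_distr_eq[OF limit_measure_measurable int_\<nu>])
  have "(\<integral>x. f x \<partial>\<mu>) = (\<integral>x. time_mean f x \<partial>\<mu>)" using integral_time_mean[OF \<mu> f B] by simp
  also have "\<dots> = (\<integral>x. indicator ?X x *\<^sub>R time_mean f x \<partial>\<mu>)"
    using AE_ergodic_support[OF \<mu>] by (intro integral_cong_AE) auto
  finally show "(\<integral>x. f x \<partial>\<mu>) = (\<integral>x\<in>?X. (\<integral>y. f y \<partial>?V x) \<partial>\<mu>)"
    unfolding set_lebesgue_integral_def eq .
  show "(\<integral>x\<in>?X. (\<integral>y. f y \<partial>?V x) \<partial>\<mu>) = (\<integral>\<nu>. (\<integral>y. f y \<partial>\<nu>) \<partial>ergodic_pushforward T \<mu>)"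
    unfolding ergodic_pushforward_eq_distr set_lebesgue_integral_def
    by (subst integral_distr[OF limit_measure_measurable int_\<nu>])
      (rule integral_restrict_space[OF ergodic_support_sets, symmetric])
qed

lemma choquet_distribution_ergodic_pushforward:
  "choquet_distribution T (ergodic_pushforward T \<mu>) \<mu>"
  unfolding choquet_distribution_def
proof (intro conjI allI impI)
  show "\<mu> \<in> invariant_measures T" by (rule \<mu>)
  show "prob_space (ergodic_pushforward T \<mu>)"
    unfolding ergodic_pushforward_eq_distr
    using prob_space_restrict limit_measure_measurable by (rule prob_space.prob_space_distr)
  show "space (ergodic_pushforward T \<mu>) = ergodic_measures T"
    by (simp add: ergodic_pushforward_eq_distr space_ergodic_borel)
  show "sets (ergodic_pushforward T \<mu>) = sets (ergodic_borel T)"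
    by (simp add: ergodic_pushforward_eq_distr)
  fix f :: "'a \<Rightarrow> real" assume f: "continuous_on UNIV f"
  obtain B where "\<And>x. \<bar>f x\<bar> \<le> B" using compact_space_continuous_bounded[OF compact f] by blast
  then show "(\<integral>x. f x \<partial>\<mu>) = (\<integral>\<nu>. (\<integral>x. f x \<partial>\<nu>) \<partial>ergodic_pushforward T \<mu>)"
    using ergodic_decomposition(3,4)[OF borel_measurable_continuous_onI[OF f], of B] by simp
qed

end

end

theorem theorem7:
  fixes T :: "'a::metric_space \<Rightarrow> 'a" and \<mu> :: "'a measure"
  assumes "compact (UNIV :: 'a set)"
    and "continuous_on UNIV T"
    and "\<mu> \<in> invariant_measures T"
  shows "choquet_distribution T (ergodic_pushforward T \<mu>) \<mu> \<and>
    (\<forall>f :: 'a \<Rightarrow> real. f \<in> borel_measurable borel \<and> bounded (range f) \<longrightarrow>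
       set_integrable \<mu> (ergodic_support T) (\<lambda>x. \<integral>y. f y \<partial>(limit_measure T x)) \<and>
       integrable (ergodic_pushforward T \<mu>) (\<lambda>\<nu>. \<integral>y. f y \<partial>\<nu>) \<and>
       (\<integral>x. f x \<partial>\<mu>) = (\<integral>x\<in>ergodic_support T. (\<integral>y. f y \<partial>(limit_measure T x)) \<partial>\<mu>) \<and>
       (\<integral>x\<in>ergodic_support T. (\<integral>y. f y \<partial>(limit_measure T x)) \<partial>\<mu>) =
         (\<integral>\<nu>. (\<integral>y. f y \<partial>\<nu>) \<partial>(ergodic_pushforward T \<mu>)))"
proof -
  interpret compact_system T using assms by unfold_locales
  show ?thesis
  proof (intro conjI[OF choquet_distribution_ergodic_pushforward[OF assms(3)]] allI impI, elim conjE)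
    fix f :: "'a \<Rightarrow> real" assume f: "f \<in> borel_measurable borel" and "bounded (range f)"
    then obtain B where "\<And>x. \<bar>f x\<bar> \<le> B" by (auto simp: bounded_iff)
    note ergodic_decomposition[OF assms(3) f this]
    then show "set_integrable \<mu> (ergodic_support T) (\<lambda>x. \<integral>y. f y \<partial>(limit_measure T x)) \<and>
       integrable (ergodic_pushforward T \<mu>) (\<lambda>\<nu>. \<integral>y. f y \<partial>\<nu>) \<and>
       (\<integral>x. f x \<partial>\<mu>) = (\<integral>x\<in>ergodic_support T. (\<integral>y. f y \<partial>(limit_measure T x)) \<partial>\<mu>) \<and>
       (\<integral>x\<in>ergodic_support T. (\<integral>y. f y \<partial>(limit_measure T x)) \<partial>\<mu>) =
         (\<integral>\<nu>. (\<integral>y. f y \<partial>\<nu>) \<partial>(ergodic_pushforward T \<mu>))"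
      by blast
  qed
qed

end
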